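(* Let $N,K,M$ be positive integers with $M\in[2:N]$, and let $\mathbf P$ be any $(N,M)$ storage design array (SDA). Then there is a capacity-achieving linear $(\mu=M/N,N,K)$ SC-PIR scheme with sub-packetization $\eta_{\mathbf P}\cdot(M-1)$, where $\eta_{\mathbf P}$ is the number of distinct columns of $\mathbf P$.
   Context: Notation: $[a:b]=\{a,a+1,\dots,b\}$; entropies are in base $q$, where $q$ is a fixed prime power; $A_{1:N}=(A_1,\dots,A_N)$. For integers $1\le M\le N$, an $(N,M)$ storage design array (SDA) is an $N\times\frac{N}{\gcd(N,M)}$ array with entries in $\{*,\mathrm{NULL}\}$ such that each column has exactly $M$ entries $*$ and each row has exactly $\frac{M}{\gcd(N,M)}$ entries $*$. A $(\mu,N,K)$ SC-PIR (storage constrained private information retrieval) scheme consists of the following. Files: $W_1,\dots,W_K$ are independent and uniform on $\mathbb F_q^L$, for some file length $L\ge1$ (part of the scheme, free to be chosen). Storage: each file $W_k$ is partitioned into $F$ disjoint nonempty packets $W_{k,1},\dots,W_{k,F}$, with $H(W_{k,i})$ not depending on $k$; $F$ is the sub-packetization. Server $n\in[1:N]$ stores $Z_n=\{W_{k,i}:k\in[1:K],i\in\mathcal Z_n\}$ for some $\mathcal Z_n\subseteq[1:F]$, every $i\in[1:F]$ lies in at least one $\mathcal Z_n$, and $H(Z_n)\le\mu KL$ for all $n$. Retrieval: for each desired index $\theta\in[1:K]$ there are random queries $Q_{1:N}^{[\theta]}$ and answers $A_{1:N}^{[\theta]}$ with $I(Q_{1:N}^{[\theta]};W_{1:K})=0$;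 $H(A_n^{[\theta]}|Q_n^{[\theta]},Z_n)=0$ for all $n$; decodability $H(W_\theta|A_{1:N}^{[\theta]},Q_{1:N}^{[\theta]})=0$; and privacy: for every $n$, the distribution of $(Q_n^{[\theta]},A_n^{[\theta]},Z_n)$ does not depend on $\theta$. The average download cost over random queries is $D=\sum_{n=1}^N H(A_n^{[\theta]}|Q_n^{[\theta]})$ and the retrieval rate is $R=L/D$. For $M=\mu N\in[1:N]$ an integer the capacity (supremum of rates) is known to be $C^*=\left(1+\frac1M+\dots+\frac1{M^{K-1}}\right)^{-1}$; a scheme is capacity-achieving if $R=C^*$. The scheme is linear if each answer has the form $A_n^{[\theta]}=(\mathbf{LC}_{n,1}^{[\theta]}(Z_n),\dots,\mathbf{LC}_{n,\ell_n}^{[\theta]}(Z_n))$ with $\mathbf{LC}_{n,j}^{[\theta]}(Z_n)=\sum_{k\in[1:K]}\sum_{i\in\mathcal Z_n}\beta_{n,k,i,j}^{[\theta]}W_{k,i}$, where the length $\ell_n$ (possibly $0$, i.e. no answer) and the coefficients $\beta_{n,k,i,j}^{[\theta]}\in\mathbb F_q$ are determined by the query $Q_n^{[\theta]}$. Packets are vectors over $\mathbb F_q$; packets of different dimensions are added after zero-padding to the largest dimension. *)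

theory Defs
  imports "HOL-Probability.Probability" "HOL-Library.More_List"
begin

section \<open>Storage design arrays\<close>

datatype sda_entry = Star | Null

text \<open>Rows are indexed by \<open>{1..N}\<close>, columns by \<open>{1..N div gcd N M}\<close>; entries
  outside this range are irrelevant.\<close>

definition sda :: "nat \<Rightarrow> nat \<Rightarrow> (nat \<Rightarrow> nat \<Rightarrow> sda_entry) \<Rightarrow> bool" where
  "sda N M P \<longleftrightarrow> 1 \<le> M \<and> M \<le> N \<and>
     (\<forall>j\<in>{1..N div gcd N M}. card {n\<in>{1..N}. P n j = Star} = M) \<and>
     (\<forall>n\<in>{1..N}. card {j\<in>{1..N div gcd N M}. P n j = Star} = M div gcd N M)"

definition sda_column :: "nat \<Rightarrow> (nat \<Rightarrow> nat \<Rightarrow> sda_entry) \<Rightarrow> nat \<Rightarrow> nat \<Rightarrow> sda_entry" where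
  "sda_column N P j = (\<lambda>n\<in>{1..N}. P n j)"

definition num_distinct_columns :: "nat \<Rightarrow> nat \<Rightarrow> (nat \<Rightarrow> nat \<Rightarrow> sda_entry) \<Rightarrow> nat" where
  "num_distinct_columns N M P = card (sda_column N P ` {1..N div gcd N M})"


section \<open>Vectors\<close>

text \<open>A vector over a finite field is a list of its coordinates.\<close>

definition vecs :: "nat \<Rightarrow> 'f list set" where
  "vecs L = {v. length v = L}"

text \<open>Sum of vectors of possibly different dimensions, each zero-padded to the largest dimension.\<close>

definition padded_sum :: "('i \<Rightarrow> 'f::comm_monoid_add list) \<Rightarrow> 'i set \<Rightarrow> 'f list" where
  "padded_sum v I =
     map (\<lambda>t. \<Sum>x\<in>I. nth_default 0 (v x) t) [0..<Max (insert 0 ((\<lambda>x. length (v x)) ` I))]"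


section \<open>Storage constrained private information retrieval\<close>

text \<open>All random variables live on one probability space \<open>\<Omega>\<close>. The field is the type \<open>'f\<close>; its
  order \<open>q\<close> is the base of all entropies. Files, servers and packets are
  numbered from 1. Coordinates of a file are numbered from 0; \<open>part k i\<close> is the set of
  coordinates of file \<open>k\<close> that form its packet \<open>i\<close>, read in increasing order.\<close>

locale sc_pir_space = information_space \<Omega> q
  for \<Omega> :: "'w measure" and q :: real
begin

text \<open>The notation of \<open>information_space\<close> is not inherited when its parameters are renamed.\<close>

abbreviation entropy_q (\<open>\<H>'(_')\<close>) where
  "\<H>(X) \<equiv> entropy q (count_space (X ` space \<Omega>)) X"

abbreviation conditional_entropy_q (\<open>\<H>'(_ | _')\<close>) where
  "\<H>(X | Y) \<equiv>
     conditional_entropy q (count_space (X ` space \<Omega>)) (count_space (Y ` space \<Omega>)) X Y"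

abbreviation mutual_information_q (\<open>\<I>'(_ ; _')\<close>) where
  "\<I>(X ; Y) \<equiv>
     mutual_information q (count_space (X ` space \<Omega>)) (count_space (Y ` space \<Omega>)) X Y"

end

locale sc_pir_files = sc_pir_space \<Omega> q
  for \<Omega> :: "'w measure" and q :: real +
  fixes K L F :: nat
    and W :: "nat \<Rightarrow> 'w \<Rightarrow> 'f::{finite,field} list"
    and part :: "nat \<Rightarrow> nat \<Rightarrow> nat set"
  assumes q_card: "q = real CARD('f)"
    and K_pos: "1 \<le> K" and L_pos: "1 \<le> L"
    and files_indep: "indep_vars (\<lambda>_. count_space (vecs L)) W {1..K}"
    and files_uniform:
      "\<And>k. k \<in> {1..K} \<Longrightarrow>
         distr \<Omega> (count_space (vecs L)) (W k) = uniform_count_measure (vecs L)"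
    and part_cover: "\<And>k. k \<in> {1..K} \<Longrightarrow> (\<Union>i\<in>{1..F}. part k i) = {..<L}"
    and part_disjoint: "\<And>k. k \<in> {1..K} \<Longrightarrow> disjoint_family_on (part k) {1..F}"
    and part_nonempty: "\<And>k i. k \<in> {1..K} \<Longrightarrow> i \<in> {1..F} \<Longrightarrow> part k i \<noteq> {}"
begin

definition packet :: "nat \<Rightarrow> nat \<Rightarrow> 'w \<Rightarrow> 'f list" where
  "packet k i \<omega> = nths (W k \<omega>) (part k i)"

definition stored :: "nat set \<Rightarrow> 'w \<Rightarrow> nat \<times> nat \<Rightarrow> 'f list" where
  "stored I \<omega> = (\<lambda>(k, i)\<in>{1..K} \<times> I. packet k i \<omega>)"

definition all_files :: "'w \<Rightarrow> nat \<Rightarrow> 'f list" where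
  "all_files \<omega> = (\<lambda>k\<in>{1..K}. W k \<omega>)"

end

locale sc_pir_storage = sc_pir_files \<Omega> q K L F W part
  for \<Omega> :: "'w measure" and q :: real and K L F :: nat
    and W :: "nat \<Rightarrow> 'w \<Rightarrow> 'f::{finite,field} list"
    and part :: "nat \<Rightarrow> nat \<Rightarrow> nat set" +
  fixes \<mu> :: real and N :: nat
    and Zset :: "nat \<Rightarrow> nat set"
  assumes N_pos: "1 \<le> N"
    and packet_size:
      "\<And>k k' i. k \<in> {1..K} \<Longrightarrow> k' \<in> {1..K} \<Longrightarrow> i \<in> {1..F} \<Longrightarrow>
         \<H>(packet k i) = \<H>(packet k' i)"
    and Zset_subset: "\<And>n. n \<in> {1..N} \<Longrightarrow> Zset n \<subseteq> {1..F}"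
    and Zset_cover: "\<And>i. i \<in> {1..F} \<Longrightarrow> \<exists>n\<in>{1..N}. i \<in> Zset n"
    and storage_constraint:
      "\<And>n. n \<in> {1..N} \<Longrightarrow> \<H>(stored (Zset n)) \<le> \<mu> * real K * real L"
begin

abbreviation Z :: "nat \<Rightarrow> 'w \<Rightarrow> nat \<times> nat \<Rightarrow> 'f list" where
  "Z n \<equiv> stored (Zset n)"

end

text \<open>\<open>Q \<theta> n\<close> and \<open>A \<theta> n\<close> are the query to and the answer of server \<open>n\<close> if file \<open>\<theta>\<close> is desired.
  The notions of entropy of the library are meaningful on finitely valued random variables, which
  is the role of the \<open>simple_function\<close> assumptions.\<close>

locale sc_pir_scheme = sc_pir_storage \<Omega> q K L F W part \<mu> N Zset
  for \<Omega> :: "'w measure" and q :: real and K L F :: nat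
    and W :: "nat \<Rightarrow> 'w \<Rightarrow> 'f::{finite,field} list"
    and part :: "nat \<Rightarrow> nat \<Rightarrow> nat set"
    and \<mu> :: real and N :: nat
    and Zset :: "nat \<Rightarrow> nat set" +
  fixes Q :: "nat \<Rightarrow> nat \<Rightarrow> 'w \<Rightarrow> 'q"
    and A :: "nat \<Rightarrow> nat \<Rightarrow> 'w \<Rightarrow> 'a"
  assumes Q_simple: "\<And>\<theta> n. \<theta> \<in> {1..K} \<Longrightarrow> n \<in> {1..N} \<Longrightarrow> simple_function \<Omega> (Q \<theta> n)"
    and A_simple: "\<And>\<theta> n. \<theta> \<in> {1..K} \<Longrightarrow> n \<in> {1..N} \<Longrightarrow> simple_function \<Omega> (A \<theta> n)"
    and queries_files:
      "\<And>\<theta>. \<theta> \<in> {1..K} \<Longrightarrow> \<I>(\<lambda>\<omega>. \<lambda>n\<in>{1..N}. Q \<theta> n \<omega> ; all_files) = 0"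
    and answers:
      "\<And>\<theta> n. \<theta> \<in> {1..K} \<Longrightarrow> n \<in> {1..N} \<Longrightarrow> \<H>(A \<theta> n | \<lambda>\<omega>. (Q \<theta> n \<omega>, Z n \<omega>)) = 0"
    and decodability:
      "\<And>\<theta>. \<theta> \<in> {1..K} \<Longrightarrow>
         \<H>(W \<theta> | \<lambda>\<omega>. (\<lambda>n\<in>{1..N}. A \<theta> n \<omega>, \<lambda>n\<in>{1..N}. Q \<theta> n \<omega>)) = 0"
    and privacy:
      "\<And>\<theta> \<theta>' n. \<theta> \<in> {1..K} \<Longrightarrow> \<theta>' \<in> {1..K} \<Longrightarrow> n \<in> {1..N} \<Longrightarrow>
         distr \<Omega> (count_space UNIV) (\<lambda>\<omega>. (Q \<theta> n \<omega>, A \<theta> n \<omega>, Z n \<omega>)) =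
         distr \<Omega> (count_space UNIV) (\<lambda>\<omega>. (Q \<theta>' n \<omega>, A \<theta>' n \<omega>, Z n \<omega>))"
begin

text \<open>By privacy, the download cost does not depend on the desired file \<open>\<theta>\<close>.\<close>

definition download_cost :: "nat \<Rightarrow> real" where
  "download_cost \<theta> = (\<Sum>n=1..N. \<H>(A \<theta> n | Q \<theta> n))"

definition retrieval_rate :: "nat \<Rightarrow> real" where
  "retrieval_rate \<theta> = real L / download_cost \<theta>"

end

text \<open>The known value of the capacity when \<open>M = \<mu> * N\<close> is an integer in \<open>{1..N}\<close>.\<close>

definition sc_pir_capacity :: "real \<Rightarrow> nat \<Rightarrow> nat \<Rightarrow> real" where
  "sc_pir_capacity \<mu> N K = inverse (\<Sum>j<K. 1 / (\<mu> * real N) ^ j)"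

text \<open>The answer of a linear scheme is a list of linear combinations of the stored packets.
  Server \<open>n\<close>, on receiving the query \<open>x\<close>, returns \<open>len n x\<close> of them, with coefficients
  \<open>coef n x k i j\<close>.\<close>

locale linear_sc_pir_scheme = sc_pir_scheme \<Omega> q K L F W part \<mu> N Zset Q A
  for \<Omega> :: "'w measure" and q :: real and K L F :: nat
    and W :: "nat \<Rightarrow> 'w \<Rightarrow> 'f::{finite,field} list"
    and part :: "nat \<Rightarrow> nat \<Rightarrow> nat set"
    and \<mu> :: real and N :: nat
    and Zset :: "nat \<Rightarrow> nat set"
    and Q :: "nat \<Rightarrow> nat \<Rightarrow> 'w \<Rightarrow> 'q"
    and A :: "nat \<Rightarrow> nat \<Rightarrow> 'w \<Rightarrow> 'f list list" +
  assumes linear_answers: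
    "\<exists>(len :: nat \<Rightarrow> 'q \<Rightarrow> nat) (coef :: nat \<Rightarrow> 'q \<Rightarrow> nat \<Rightarrow> nat \<Rightarrow> nat \<Rightarrow> 'f).
       \<forall>\<theta>\<in>{1..K}. \<forall>n\<in>{1..N}. \<forall>\<omega>\<in>space \<Omega>.
         A \<theta> n \<omega> =
           map (\<lambda>j. padded_sum (\<lambda>(k, i). map ((*) (coef n (Q \<theta> n \<omega>) k i j)) (packet k i \<omega>))
                      ({1..K} \<times> Zset n))
             [1..<Suc (len n (Q \<theta> n \<omega>))]"

locale capacity_achieving_linear_sc_pir_scheme =
  linear_sc_pir_scheme \<Omega> q K L F W part \<mu> N Zset Q A
  for \<Omega> :: "'w measure" and q :: real and K L F :: nat
    and W :: "nat \<Rightarrow> 'w \<Rightarrow> 'f::{finite,field} list"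
    and part :: "nat \<Rightarrow> nat \<Rightarrow> nat set"
    and \<mu> :: real and N :: nat
    and Zset :: "nat \<Rightarrow> nat set"
    and Q :: "nat \<Rightarrow> nat \<Rightarrow> 'w \<Rightarrow> 'q"
    and A :: "nat \<Rightarrow> nat \<Rightarrow> 'w \<Rightarrow> 'f list list" +
  assumes capacity_achieving: "\<And>\<theta>. \<theta> \<in> {1..K} \<Longrightarrow> retrieval_rate \<theta> = sc_pir_capacity \<mu> N K"

end

theory Submission
  imports Defs
begin

text \<open>Equal columns of the array form a class, and each class \<open>c\<close> is served by the \<open>M\<close> servers starred
  in it, using the code of Tian, Sun and Chen with \<open>M - 1\<close> packets per file. A key assigns to each
  class \<open>c\<close> and file \<open>k\<close> an independent uniform residue \<open>g (c, k)\<close> modulo \<open>M\<close>. The server in position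
  \<open>p\<close> of class \<open>c\<close> is asked for the sum over \<open>k\<close> of the packets numbered \<open>g (c, k)\<close>, where
  \<open>g (c, \<theta>)\<close> is replaced by \<open>g (c, \<theta>) + p\<close> and packet 0 is zero. As \<open>p\<close> varies, the packet of the
  desired file runs through all residues, so subtracting the answer with residue 0 from the others
  decodes it. Each query is uniform, hence private, and it is zero, hence free of cost, with
  probability \<open>1 / M ^ K\<close>. A class with \<open>m\<close> columns therefore costs \<open>m * M * (1 - 1 / M ^ K)\<close>
  symbols for \<open>m * (M - 1)\<close> desired ones, which is the capacity. Entropies on the uniform sample
  space reduce to counting fibres.\<close>

section \<open>Entropy on uniform spaces\<close>

locale finite_uniform =
  fixes T :: "'w set" and b :: real
  assumes finite_T: "finite T" and T_ne: "T \<noteq> {}" and b_gt: "1 < b"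
begin

sublocale information_space "uniform_count_measure T" b
proof -
  interpret prob_space "uniform_count_measure T"
    using finite_T T_ne by (rule prob_space_uniform_count_measure)
  show "information_space (uniform_count_measure T) b"
    by unfold_locales (rule b_gt)
qed

abbreviation U :: "'w measure" where "U \<equiv> uniform_count_measure T"

lemma space_U: "space U = T"
  by (rule space_uniform_count_measure)

lemma card_T_pos: "0 < card T"
  using finite_T T_ne by (simp add: card_gt_0_iff)

lemma simple_function_U: "simple_function U X"
  using finite_T by (auto simp: simple_function_def space_U sets_uniform_count_measure)

lemma prob_U: "prob {\<omega>\<in>T. \<phi> \<omega>} = card {\<omega>\<in>T. \<phi> \<omega>} / card T"
  by (rule measure_uniform_count_measure[OF finite_T]) auto

lemma simple_distributed_U:
  "simple_distributed U X (\<lambda>x. card {\<omega>\<in>T. X \<omega> = x} / card T)"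
proof (rule simple_distributedI[OF simple_function_U])
  fix x
  have "X -` {x} \<inter> space U = {\<omega>\<in>T. X \<omega> = x}"
    by (auto simp: space_U)
  then show "card {\<omega>\<in>T. X \<omega> = x} / card T = prob (X -` {x} \<inter> space U)"
    by (simp add: prob_U)
qed simp

lemma sum_over_range:
  fixes f :: "'x \<Rightarrow> real"
  shows "(\<Sum>x\<in>X ` T. card {\<omega>\<in>T. X \<omega> = x} * f x) = (\<Sum>\<omega>\<in>T. f (X \<omega>))"
proof -
  have "(\<Sum>\<omega>\<in>T. f (X \<omega>)) = (\<Sum>x\<in>X ` T. \<Sum>\<omega>\<in>{\<omega>\<in>T. X \<omega> = x}. f (X \<omega>))"
    by (rule sum.image_gen[OF finite_T])
  also have "\<dots> = (\<Sum>x\<in>X ` T. card {\<omega>\<in>T. X \<omega> = x} * f x)"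
    by (rule sum.cong) simp_all
  finally show ?thesis by simp
qed

lemma entropy_le_log_card:
  "entropy b (count_space (X ` T)) X \<le> log b (card (X ` T))"
  using entropy_le_card[OF simple_distributed_U, of X] by (simp add: space_U)

text \<open>On the fibre \<open>Y = y\<close> every value of \<open>X\<close> has the same
  conditional probability \<open>1 / c y\<close>, so \<open>X\<close> is uniform there and
  contributes \<open>log b (c y)\<close>. Averaging over the sample space gives the entropy.\<close>

lemma conditional_entropy_fibres:
  assumes "\<And>\<omega>. \<omega> \<in> T \<Longrightarrow>
    c (Y \<omega>) * card {\<omega>'\<in>T. X \<omega>' = X \<omega> \<and> Y \<omega>' = Y \<omega>} = card {\<omega>'\<in>T. Y \<omega>' = Y \<omega>}"
  shows "conditional_entropy b (count_space (X ` T)) (count_space (Y ` T)) X Y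
           = (\<Sum>\<omega>\<in>T. log b (c (Y \<omega>))) / card T"
proof -
  let ?XY = "\<lambda>\<omega>. (X \<omega>, Y \<omega>)"
  let ?p = "\<lambda>z. card {\<omega>\<in>T. ?XY \<omega> = z} / card T"
  have "conditional_entropy b (count_space (X ` T)) (count_space (Y ` T)) X Y =
     - (\<Sum>(x, y)\<in>?XY ` T. ?p (x, y) * log b (?p (x, y) / (card {\<omega>\<in>T. Y \<omega> = y} / card T)))"
    using conditional_entropy_eq[OF simple_distributed_U simple_distributed_U, of X Y]
    by (simp add: space_U)
  also have "\<dots> = (\<Sum>z\<in>?XY ` T. card {\<omega>\<in>T. ?XY \<omega> = z} * (log b (c (snd z)) / card T))"
  proof (unfold sum_negf[symmetric], rule sum.cong[OF refl], safe)
    fix \<omega> assume w: "\<omega> \<in> T"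
    let ?a = "card {\<omega>'\<in>T. X \<omega>' = X \<omega> \<and> Y \<omega>' = Y \<omega>}"
    let ?d = "card {\<omega>'\<in>T. Y \<omega>' = Y \<omega>}"
    have a: "?a > 0" using w finite_T by (auto simp: card_gt_0_iff)
    have d: "?d > 0" using w finite_T by (auto simp: card_gt_0_iff)
    have eq: "c (Y \<omega>) * ?a = ?d" by (rule assms[OF w])
    then have c: "c (Y \<omega>) > 0" using d by (cases "c (Y \<omega>)") auto
    have "real ?a / card T / (?d / card T) = 1 / c (Y \<omega>)"
      using a c d card_T_pos by (simp flip: eq)
    then have "log b (real ?a / card T / (?d / card T)) = - log b (c (Y \<omega>))"
      using c b_gt by (simp add: log_divide)
    then show "- (?p (?XY \<omega>) * log b (?p (?XY \<omega>) / (?d / card T))) =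
        card {\<omega>'\<in>T. ?XY \<omega>' = ?XY \<omega>} * (log b (c (snd (?XY \<omega>))) / card T)"
      by simp
  qed
  also have "\<dots> = (\<Sum>\<omega>\<in>T. log b (c (snd (?XY \<omega>))) / card T)"
    by (rule sum_over_range)
  finally show ?thesis by (simp add: sum_divide_distrib)
qed

text \<open>Each fibre of \<open>Y\<close> carries a single value of \<open>X\<close>, which is the
  case \<open>c = 1\<close> of conditional uniformity. Answers and decodability are verified in this
  form.\<close>

lemma conditional_entropy_function:
  assumes "\<And>\<omega> \<omega>'. \<omega> \<in> T \<Longrightarrow> \<omega>' \<in> T \<Longrightarrow> Y \<omega> = Y \<omega>' \<Longrightarrow> X \<omega> = X \<omega>'"
  shows "conditional_entropy b (count_space (X ` T)) (count_space (Y ` T)) X Y = 0"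
proof -
  have "{\<omega>'\<in>T. X \<omega>' = X \<omega> \<and> Y \<omega>' = Y \<omega>} = {\<omega>'\<in>T. Y \<omega>' = Y \<omega>}" if "\<omega> \<in> T" for \<omega>
    using assms[OF _ that] by auto
  then show ?thesis
    by (subst conditional_entropy_fibres[where c = "\<lambda>_. 1"]) auto
qed

text \<open>The hypothesis is independence with denominators cleared; every logarithm in the mutual
  information is then \<open>log b 1\<close>.\<close>

lemma mutual_information_eq_0:
  assumes "\<And>\<omega>. \<omega> \<in> T \<Longrightarrow>
    card {\<omega>'\<in>T. X \<omega>' = X \<omega> \<and> Y \<omega>' = Y \<omega>} * card T =
    card {\<omega>'\<in>T. X \<omega>' = X \<omega>} * card {\<omega>'\<in>T. Y \<omega>' = Y \<omega>}"
  shows "mutual_information b (count_space (X ` T)) (count_space (Y ` T)) X Y = 0"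
proof -
  let ?XY = "\<lambda>\<omega>. (X \<omega>, Y \<omega>)"
  let ?p = "\<lambda>z. card {\<omega>\<in>T. ?XY \<omega> = z} / card T"
  have "mutual_information b (count_space (X ` T)) (count_space (Y ` T)) X Y =
     (\<Sum>(x, y)\<in>?XY ` T. ?p (x, y) * log b (?p (x, y) /
        (card {\<omega>\<in>T. X \<omega> = x} / card T * (card {\<omega>\<in>T. Y \<omega> = y} / card T))))"
    using mutual_information_simple_distributed[OF simple_distributed_U simple_distributed_U
        simple_distributed_U, of X Y]
    by (simp add: space_U)
  also have "\<dots> = 0"
  proof (rule sum.neutral, safe)
    fix \<omega> assume w: "\<omega> \<in> T"
    let ?a = "card {\<omega>'\<in>T. X \<omega>' = X \<omega> \<and> Y \<omega>' = Y \<omega>}"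
    let ?d = "card {\<omega>'\<in>T. Y \<omega>' = Y \<omega>}"
    let ?e = "card {\<omega>'\<in>T. X \<omega>' = X \<omega>}"
    have e: "?e > 0" using w finite_T by (auto simp: card_gt_0_iff)
    have d: "?d > 0" using w finite_T by (auto simp: card_gt_0_iff)
    have a: "?a > 0" using w finite_T by (auto simp: card_gt_0_iff)
    have "real ?a * card T = real ?e * ?d"
      using assms[OF w] by (simp flip: of_nat_mult)
    then have "real ?a / card T / (?e / card T * (?d / card T)) = 1"
      using a card_T_pos e d by (simp add: field_simps)
    then show "?p (?XY \<omega>) * log b (?p (?XY \<omega>) / (?e / card T * (?d / card T))) = 0"
      by simp
  qed
  finally show ?thesis .
qed

text \<open>Full power sets serve as generators. They are stable under intersection and contain the
  whole space, so the product formula for the full family covers subfamilies as well: missing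
  indices receive the whole space.\<close>

lemma indep_vars_by_counting:
  assumes I: "finite I" "I \<noteq> {}"
    and X: "\<And>i \<omega>. i \<in> I \<Longrightarrow> \<omega> \<in> T \<Longrightarrow> X i \<omega> \<in> V i"
    and count: "\<And>B. (\<And>i. i \<in> I \<Longrightarrow> B i \<subseteq> V i) \<Longrightarrow>
      card {\<omega>\<in>T. \<forall>i\<in>I. X i \<omega> \<in> B i} / card T = (\<Prod>i\<in>I. card {\<omega>\<in>T. X i \<omega> \<in> B i} / card T)"
  shows "indep_vars (\<lambda>i. count_space (V i)) X I"
proof (subst indep_vars_finite[where E = "\<lambda>i. Pow (V i)"])
  show "I \<noteq> {}" "finite I" by (rule I)+
  fix i assume i: "i \<in> I"
  show "sets (count_space (V i)) = sigma_sets (space (count_space (V i))) (Pow (V i))"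
    by (metis sets_count_space space_count_space sets.sigma_sets_eq)
  show "random_variable (count_space (V i)) (X i)"
    using X[OF i] by (auto simp: measurable_def space_U sets_uniform_count_measure)
  show "Int_stable (Pow (V i))" by (auto simp: Int_stable_def)
  show "space (count_space (V i)) \<in> Pow (V i)" by simp
  show "Pow (V i) \<subseteq> Pow (space (count_space (V i)))" by simp
next
  show "\<forall>B\<in>(\<Pi> i\<in>I. Pow (V i)). prob (\<Inter>j\<in>I. X j -` B j \<inter> space U) =
      (\<Prod>j\<in>I. prob (X j -` B j \<inter> space U))"
  proof
    fix B assume B: "B \<in> (\<Pi> i\<in>I. Pow (V i))"
    have 1: "(\<Inter>j\<in>I. {\<omega>\<in>T. X j \<omega> \<in> B j}) = {\<omega>\<in>T. \<forall>i\<in>I. X i \<omega> \<in> B i}"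
      using I by auto
    have 2: "X j -` B j \<inter> space U = {\<omega>\<in>T. X j \<omega> \<in> B j}" for j
      by (auto simp: space_U)
    show "prob (\<Inter>j\<in>I. X j -` B j \<inter> space U) = (\<Prod>j\<in>I. prob (X j -` B j \<inter> space U))"
      unfolding 2 1 prob_U using B by (intro count) auto
  qed
qed

end

text \<open>A bijection of uniform spaces preserves the number of points in an event. Privacy uses
  this twice: to pass from sample points to pairs of files and key, and to absorb the shift of the
  key.\<close>

lemma distr_uniform_count_measure_bij:
  assumes h: "bij_betw h T S" and T: "finite T"
  shows "distr (uniform_count_measure T) (count_space UNIV) (\<lambda>\<omega>. X (h \<omega>)) =
         distr (uniform_count_measure S) (count_space UNIV) X"
proof (rule measure_eqI)
  fix A assume "A \<in> sets (distr (uniform_count_measure T) (count_space UNIV) (\<lambda>\<omega>. X (h \<omega>)))"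
  have S: "finite S" using h T bij_betw_finite by blast
  have "bij_betw h {\<omega>\<in>T. X (h \<omega>) \<in> A} {s\<in>S. X s \<in> A}"
    using h by (auto simp: bij_betw_def inj_on_def)
  then have 1: "card {\<omega>\<in>T. X (h \<omega>) \<in> A} = card {s\<in>S. X s \<in> A}"
    by (rule bij_betw_same_card)
  have 2: "card T = card S" using h by (rule bij_betw_same_card)
  have "emeasure (distr (uniform_count_measure T) (count_space UNIV) (\<lambda>\<omega>. X (h \<omega>))) A
     = emeasure (uniform_count_measure T) {\<omega>\<in>T. X (h \<omega>) \<in> A}"
    by (subst emeasure_distr)
       (auto simp: measurable_def sets_uniform_count_measure space_uniform_count_measure
         intro!: arg_cong2[where f = emeasure])
  also have "\<dots> = emeasure (uniform_count_measure S) {s\<in>S. X s \<in> A}"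
    using 1 2 T S by (simp add: emeasure_uniform_count_measure)
  also have "\<dots> = emeasure (distr (uniform_count_measure S) (count_space UNIV) X) A"
    by (subst emeasure_distr)
       (auto simp: measurable_def sets_uniform_count_measure space_uniform_count_measure
         intro!: arg_cong2[where f = emeasure])
  finally show "emeasure (distr (uniform_count_measure T) (count_space UNIV) (\<lambda>\<omega>. X (h \<omega>))) A =
     emeasure (distr (uniform_count_measure S) (count_space UNIV) X) A" .
qed simp

section \<open>Counting and indexing\<close>

lemma nths_eq_map_filter: "nths xs A = map ((!) xs) (filter (\<lambda>i. i \<in> A) [0..<length xs])"
proof -
  have "nths xs A = nths (map ((!) xs) [0..<length xs]) A"
    by (simp add: map_nth)
  also have "\<dots> = map ((!) xs) (nths [0..<length xs] A)"
    by (rule nths_map)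
  \<comment> \<open>In \<open>[0..<length xs]\<close> every entry equals its own position, so
    selecting by position and filtering by value agree.\<close>
  also have "nths [0..<length xs] A = filter (\<lambda>i. i \<in> A) [0..<length xs]"
    unfolding filter_eq_nths[of "\<lambda>i. i \<in> A"]
    by (simp add: nths_def) (rule arg_cong[where f = "map fst"], rule filter_cong, auto simp: set_zip)
  finally show ?thesis .
qed

lemma mult_add_less:
  fixes j J r R :: nat
  assumes "j < J" "r < R"
  shows "j * R + r < J * R"
proof -
  have "j * R + r < Suc j * R" using assms by simp
  also have "\<dots> \<le> J * R" using assms by (intro mult_right_mono) auto
  finally show ?thesis .
qed

text \<open>For fixed remainder \<open>r\<close> the map from \<open>j\<close> to
  \<open>j * R + r\<close> is increasing, so both sides are sorted lists without repetition and with
  the same elements.\<close>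

lemma filter_div_mod:
  fixes R :: nat
  assumes "r < R"
  shows "filter (\<lambda>t. p (t div R) \<and> t mod R = r) [0..<J * R] = map (\<lambda>j. j * R + r) (filter p [0..<J])"
proof (rule sorted_distinct_set_unique)
  show "sorted (map (\<lambda>j. j * R + r) (filter p [0..<J]))"
    by (rule sorted_map_mono) (auto intro!: mono_onI sorted_wrt_filter)
  show "distinct (map (\<lambda>j. j * R + r) (filter p [0..<J]))"
    using assms by (auto simp: distinct_map inj_on_def)
  have "t \<in> (\<lambda>j. j * R + r) ` {j. j < J \<and> p j}" if "t < J * R" "p (t div R)" "t mod R = r" for t
    using that by (intro image_eqI[of _ _ "t div R"]) (auto simp: less_mult_imp_div_less)
  then show "set (filter (\<lambda>t. p (t div R) \<and> t mod R = r) [0..<J * R]) =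
      set (map (\<lambda>j. j * R + r) (filter p [0..<J]))"
    using assms by (auto simp: mult_add_less)
qed (auto intro: sorted_wrt_filter)

text \<open>The equations \<open>f x d = a d\<close> are solved for the pivot coordinates \<open>piv d\<close>, so the
  remaining coordinates parametrise the solution set.\<close>

lemma card_fibre_pivots:
  fixes \<phi> :: "'x \<Rightarrow> 'c \<Rightarrow> 'f::finite" and f :: "'x \<Rightarrow> 'd \<Rightarrow> 'f"
  assumes fin: "finite X" "finite C" and card: "card X = CARD('f) ^ card C"
    and inj_phi: "\<And>x x'. x \<in> X \<Longrightarrow> x' \<in> X \<Longrightarrow> (\<And>c. c \<in> C \<Longrightarrow> \<phi> x c = \<phi> x' c) \<Longrightarrow> x = x'"
    and piv: "inj_on piv D" "piv ` D \<subseteq> C"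
    and solve: "\<And>x x' d. x \<in> X \<Longrightarrow> x' \<in> X \<Longrightarrow> (\<And>c. c \<in> C - piv ` D \<Longrightarrow> \<phi> x c = \<phi> x' c) \<Longrightarrow>
      d \<in> D \<Longrightarrow> f x d = f x' d \<Longrightarrow> \<phi> x (piv d) = \<phi> x' (piv d)"
  shows "CARD('f) ^ card D * card {x\<in>X. \<forall>d\<in>D. f x d = a d} = card X"
proof -
  let ?E = "C - piv ` D"
  let ?\<psi> = "\<lambda>x. (restrict (f x) D, restrict (\<phi> x) ?E)"
  let ?Y = "(D \<rightarrow>\<^sub>E (UNIV :: 'f set)) \<times> (?E \<rightarrow>\<^sub>E (UNIV :: 'f set))"
  have finD: "finite D" using fin piv by (metis finite_imageD finite_subset)
  have cardD: "card (piv ` D) = card D" by (rule card_image[OF piv(1)])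
  have le: "card D \<le> card C" using card_mono[OF fin(2) piv(2)] cardD by simp
  have cardE: "card ?E = card C - card D"
    using piv cardD by (simp add: card_Diff_subset finD)
  have inj: "inj_on ?\<psi> X"
  proof (rule inj_onI)
    fix x x' assume x: "x \<in> X" "x' \<in> X" and eq: "?\<psi> x = ?\<psi> x'"
    have r: "restrict (f x) D = restrict (f x') D" "restrict (\<phi> x) ?E = restrict (\<phi> x') ?E"
      using eq by blast+
    have f: "f x d = f x' d" if "d \<in> D" for d
      using fun_cong[OF r(1), of d] that by simp
    have E: "\<phi> x c = \<phi> x' c" if "c \<in> ?E" for c
      using fun_cong[OF r(2), of c] that by simp
    show "x = x'"
      using E solve[OF x E _ f] by (intro inj_phi[OF x]) blast
  qed
  have cardE': "card (?E \<rightarrow>\<^sub>E (UNIV :: 'f set)) = CARD('f) ^ (card C - card D)"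
    using fin(2) by (simp add: card_PiE cardE)
  have finY: "finite ?Y"
    using finD fin(2) by (intro finite_cartesian_product finite_PiE) auto
  have cardY: "card ?Y = card X"
    using finD le by (simp add: card_cartesian_product cardE' card card_PiE flip: power_add)
  \<comment> \<open>\<open>?\<psi>\<close> trades each pivot coordinate for the value of one
    equation. Hence \<open>X\<close> and \<open>?Y\<close> are equally large, and the injection is
    onto.\<close>
  have surj: "?\<psi> ` X = ?Y"
    using cardY by (intro card_subset_eq[OF finY] image_subsetI SigmaI restrict_PiE_iff[THEN iffD2])
      (simp_all add: card_image[OF inj])
  \<comment> \<open>Under this bijection a solution set becomes one prescribed tuple of values times
    all choices of the free coordinates.\<close>
  have "?\<psi> ` {x\<in>X. \<forall>d\<in>D. f x d = a d} = {restrict a D} \<times> (?E \<rightarrow>\<^sub>E UNIV)"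
  proof
    show "?\<psi> ` {x\<in>X. \<forall>d\<in>D. f x d = a d} \<subseteq> {restrict a D} \<times> (?E \<rightarrow>\<^sub>E UNIV)"
    proof (rule image_subsetI)
      fix x assume "x \<in> {x\<in>X. \<forall>d\<in>D. f x d = a d}"
      then have "restrict (f x) D = restrict a D" by (intro restrict_ext) auto
      then show "?\<psi> x \<in> {restrict a D} \<times> (?E \<rightarrow>\<^sub>E UNIV)"
        by (intro SigmaI restrict_PiE_iff[THEN iffD2]) simp_all
    qed
    show "{restrict a D} \<times> (?E \<rightarrow>\<^sub>E UNIV) \<subseteq> ?\<psi> ` {x\<in>X. \<forall>d\<in>D. f x d = a d}"
    proof
      fix y assume y: "y \<in> {restrict a D} \<times> (?E \<rightarrow>\<^sub>E (UNIV :: 'f set))"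
      then have "y \<in> ?Y" by (auto simp: restrict_PiE_iff)
      then obtain x where x: "x \<in> X" "y = ?\<psi> x" using surj by blast
      then have r: "restrict (f x) D = restrict a D" using y by blast
      have "\<forall>d\<in>D. f x d = a d"
      proof
        fix d assume "d \<in> D"
        then show "f x d = a d" using fun_cong[OF r, of d] by simp
      qed
      then show "y \<in> ?\<psi> ` {x\<in>X. \<forall>d\<in>D. f x d = a d}" using x by blast
    qed
  qed
  moreover have "card (?\<psi> ` {x\<in>X. \<forall>d\<in>D. f x d = a d}) = card {x\<in>X. \<forall>d\<in>D. f x d = a d}"
    by (rule card_image) (rule inj_on_subset[OF inj], auto)
  ultimately have "card {x\<in>X. \<forall>d\<in>D. f x d = a d} = CARD('f) ^ (card C - card D)"
    by (simp add: card_cartesian_product cardE')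
  then show ?thesis
    using le by (simp add: card flip: power_add)
qed

section \<open>Counting files and keys\<close>

lemma card_vecs: "card (vecs L :: 'f::finite list set) = CARD('f) ^ L"
  and finite_vecs: "finite (vecs L :: 'f::finite list set)"
proof -
  have eq: "vecs L = {xs :: 'f list. set xs \<subseteq> UNIV \<and> length xs = L}" by (auto simp: vecs_def)
  show "card (vecs L :: 'f list set) = CARD('f) ^ L"
    unfolding eq by (rule card_lists_length_eq) simp
  show "finite (vecs L :: 'f list set)"
    unfolding eq by (rule finite_lists_length_eq) simp
qed

text \<open>The \<open>j\<close>-th coordinate block of a file has \<open>R\<close> rows. Row \<open>0\<close> in \<open>v\<close> stands for the zero
  symbol and row \<open>r > 0\<close> for coordinate \<open>j * R + (r - 1)\<close>.\<close>

definition column_answer ::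
    "nat \<Rightarrow> nat \<Rightarrow> (nat \<Rightarrow> nat) \<Rightarrow> (nat \<times> nat \<Rightarrow> nat) \<Rightarrow> (nat \<Rightarrow> 'f::comm_ring list) \<Rightarrow> nat \<Rightarrow> 'f" where
  "column_answer K R idx v w j =
     (\<Sum>k=1..K. if v (idx j, k) = 0 then 0 else w k ! (j * R + (v (idx j, k) - 1)))"

text \<open>The number of active columns is the number of field symbols that an answer to
  \<open>v\<close> carries once the query is known.\<close>

definition active :: "nat \<Rightarrow> nat \<Rightarrow> (nat \<Rightarrow> nat) \<Rightarrow> (nat \<times> nat \<Rightarrow> nat) \<Rightarrow> nat set" where
  "active J K idx v = {j\<in>{..<J}. \<exists>k\<in>{1..K}. v (idx j, k) \<noteq> 0}"

lemma column_answer_inactive: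
  "j < J \<Longrightarrow> j \<notin> active J K idx v \<Longrightarrow> column_answer K R idx v w j = 0"
  by (auto simp: column_answer_def active_def intro!: sum.neutral)

text \<open>Different columns read disjoint sets of coordinates, and an active column reads at least
  one with coefficient 1. The answers of the active columns are therefore independent linear
  equations, each of which divides the number of files by the field size.\<close>

lemma card_files_same_answers:
  fixes w0 :: "nat \<Rightarrow> 'f::{finite,comm_ring} list"
  assumes v: "\<And>j k. j < J \<Longrightarrow> k \<in> {1..K} \<Longrightarrow> v (idx j, k) \<le> R"
  shows "CARD('f) ^ card (active J K idx v) *
     card {w\<in>{1..K} \<rightarrow>\<^sub>E vecs (J * R). \<forall>j<J. column_answer K R idx v w j = column_answer K R idx v w0 j}
     = card ({1..K} \<rightarrow>\<^sub>E (vecs (J * R) :: 'f list set))"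
proof -
  let ?X = "{1..K} \<rightarrow>\<^sub>E (vecs (J * R) :: 'f list set)"
  let ?C = "{1..K} \<times> {..<J * R}"
  let ?D = "active J K idx v"
  let ?\<phi> = "\<lambda>w c. w (fst c) ! snd c :: 'f"
  let ?f = "column_answer K R idx v :: (nat \<Rightarrow> 'f list) \<Rightarrow> nat \<Rightarrow> 'f"
  \<comment> \<open>\<open>\<kappa> j\<close> is any file that contributes to the active column
    \<open>j\<close>; the coordinate read from it is the pivot of that column.\<close>
  define \<kappa> where "\<kappa> j = (SOME k. k \<in> {1..K} \<and> v (idx j, k) \<noteq> 0)" for j
  have \<kappa>: "\<kappa> j \<in> {1..K}" "v (idx j, \<kappa> j) \<noteq> 0" if "j \<in> ?D" for j
    using that someI_ex[of "\<lambda>k. k \<in> {1..K} \<and> v (idx j, k) \<noteq> 0"]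
    unfolding \<kappa>_def active_def by blast+
  define pos where "pos j k = (k, j * R + (v (idx j, k) - 1))" for j k
  have pos_bound: "snd (pos j k) < J * R \<and> snd (pos j k) div R = j"
    if "j < J" "k \<in> {1..K}" "v (idx j, k) \<noteq> 0" for j k
  proof -
    have s: "v (idx j, k) - 1 < R" using v[OF that(1,2)] that(3) by linarith
    from mult_add_less[OF that(1) this] s show ?thesis by (simp add: pos_def)
  qed
  have bound: "snd (pos j (\<kappa> j)) < J * R" "snd (pos j (\<kappa> j)) div R = j" if "j \<in> ?D" for j
    using pos_bound[OF _ \<kappa>[OF that]] that by (simp_all add: active_def)
  have "CARD('f) ^ card ?D * card {w\<in>?X. \<forall>j\<in>?D. ?f w j = ?f w0 j} = card ?X"
  proof (rule card_fibre_pivots[where C = ?C and \<phi> = ?\<phi> and piv = "\<lambda>j. pos j (\<kappa> j)"])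
    show "finite ?X" by (intro finite_PiE) (auto simp: finite_vecs)
    show "finite ?C" by simp
    show "card ?X = CARD('f) ^ card ?C"
      by (simp add: card_PiE card_vecs card_cartesian_product mult.commute flip: power_mult)
    show "w = w'" if ww: "w \<in> ?X" "w' \<in> ?X" and agree: "\<And>c. c \<in> ?C \<Longrightarrow> ?\<phi> w c = ?\<phi> w' c" for w w'
    proof (rule PiE_ext[OF ww])
      fix k assume k: "k \<in> {1..K}"
      then have "length (w k) = J * R" "length (w' k) = J * R"
        using ww by (auto simp: vecs_def PiE_iff)
      moreover have "w k ! t = w' k ! t" if "t < J * R" for t
        using agree[of "(k, t)"] that k by simp
      ultimately show "w k = w' k"
        by (intro nth_equalityI) simp_all
    qed
    show "inj_on (\<lambda>j. pos j (\<kappa> j)) ?D"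
    proof (rule inj_onI)
      fix j j' assume "j \<in> ?D" "j' \<in> ?D" and eq: "pos j (\<kappa> j) = pos j' (\<kappa> j')"
      then show "j = j'"
        using eq by (metis bound(2))
    qed
    show "(\<lambda>j. pos j (\<kappa> j)) ` ?D \<subseteq> ?C"
    proof
      fix c assume "c \<in> (\<lambda>j. pos j (\<kappa> j)) ` ?D"
      then obtain j where j: "j \<in> ?D" "c = pos j (\<kappa> j)" by blast
      then show "c \<in> ?C"
        using \<kappa>(1)[OF j(1)] bound(1)[OF j(1)] by (simp add: pos_def)
    qed
    fix w w' d
    assume agree: "\<And>c. c \<in> ?C - (\<lambda>j. pos j (\<kappa> j)) ` ?D \<Longrightarrow> ?\<phi> w c = ?\<phi> w' c"
      and d: "d \<in> ?D" and eq: "?f w d = ?f w' d"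
    have dJ: "d < J" using d by (simp add: active_def)
    let ?g = "\<lambda>w k. if v (idx d, k) = 0 then 0 else w k ! (d * R + (v (idx d, k) - 1)) :: 'f"
    have g_eq: "?g w k = ?g w' k" if k: "k \<in> {1..K} - {\<kappa> d}" for k
    proof (cases "v (idx d, k) = 0")
      case False
      \<comment> \<open>Dividing a position by \<open>R\<close> recovers its column, so only the
        pivot of \<open>d\<close> itself could coincide with this coordinate; that pivot lies in
        file \<open>\<kappa> d\<close>, which differs from \<open>k\<close>.\<close>
      have "pos d k \<notin> (\<lambda>j. pos j (\<kappa> j)) ` ?D"
      proof
        assume "pos d k \<in> (\<lambda>j. pos j (\<kappa> j)) ` ?D"
        then obtain j where j: "j \<in> ?D" "pos d k = pos j (\<kappa> j)" by blast
        have "j = d"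
          using bound(2)[OF j(1)] pos_bound[OF dJ _ False] j(2) k by simp
        then show False using j k by (auto simp: pos_def)
      qed
      moreover have "pos d k \<in> ?C"
        using pos_bound[OF dJ _ False] k by (auto simp: pos_def)
      ultimately have "pos d k \<in> ?C - (\<lambda>j. pos j (\<kappa> j)) ` ?D" by (rule DiffI[rotated])
      then have "?\<phi> w (pos d k) = ?\<phi> w' (pos d k)" by (rule agree)
      then show ?thesis using False by (simp add: pos_def)
    qed simp
    have rest: "(\<Sum>k\<in>{1..K} - {\<kappa> d}. ?g w k) = (\<Sum>k\<in>{1..K} - {\<kappa> d}. ?g w' k)"
      by (rule sum.cong[OF refl]) (rule g_eq)
    have split: "?f u d = ?g u (\<kappa> d) + (\<Sum>k\<in>{1..K} - {\<kappa> d}. ?g u k)" for u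
      unfolding column_answer_def by (rule sum.remove) (use \<kappa>[OF d] in auto)
    have "?g w (\<kappa> d) = ?g w' (\<kappa> d)"
      using eq unfolding split[of w] split[of w'] rest by (rule add_right_imp_eq)
    then show "?\<phi> w (pos d (\<kappa> d)) = ?\<phi> w' (pos d (\<kappa> d))"
      using \<kappa>[OF d] by (simp add: pos_def)
  qed
  moreover have "{w\<in>?X. \<forall>j\<in>?D. ?f w j = ?f w0 j} = {w\<in>?X. \<forall>j<J. ?f w j = ?f w0 j}"
  proof -
    have "?f w j = ?f w0 j" if "j < J" "j \<notin> ?D" for w j
      using that by (simp add: column_answer_inactive)
    moreover have "j < J" if "j \<in> ?D" for j
      using that by (simp add: active_def)
    ultimately have "(\<forall>j\<in>?D. ?f w j = ?f w0 j) \<longleftrightarrow> (\<forall>j<J. ?f w j = ?f w0 j)" for w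
      by meson
    then show ?thesis by simp
  qed
  ultimately show ?thesis by (simp only:)
qed

text \<open>The condition replaces the \<open>K\<close> factors \<open>M\<close> that belong to
  class \<open>c\<close> by 1 and leaves all other classes free.\<close>

lemma card_PiE_zero_column:
  fixes c \<eta> K M :: nat
  assumes "c < \<eta>" "0 < M"
  shows "M ^ K * card {g\<in>({..<\<eta>} \<times> {1..K}) \<rightarrow>\<^sub>E {..<M}. \<forall>k\<in>{1..K}. g (c, k) = 0} =
    card (({..<\<eta>} \<times> {1..K}) \<rightarrow>\<^sub>E {..<M})"
proof -
  let ?I = "{..<\<eta>} \<times> {1..K}"
  let ?B = "\<lambda>p. if fst p = c then {0} else {..<M}"
  have eq: "{g\<in>?I \<rightarrow>\<^sub>E {..<M}. \<forall>k\<in>{1..K}. g (c, k) = 0} = PiE ?I ?B"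
  proof (rule set_eqI)
    fix g
    have "(\<forall>p\<in>?I. g p \<in> ?B p) \<longleftrightarrow> (\<forall>p\<in>?I. g p \<in> {..<M}) \<and> (\<forall>k\<in>{1..K}. g (c, k) = 0)"
    proof (intro iffI conjI ballI)
      fix p assume "\<forall>p\<in>?I. g p \<in> ?B p" "p \<in> ?I"
      then have "g p \<in> ?B p" by blast
      then show "g p \<in> {..<M}" using assms by (simp split: if_splits)
    next
      fix k assume "\<forall>p\<in>?I. g p \<in> ?B p" "k \<in> {1..K}"
      moreover have "(c, k) \<in> ?I" using assms \<open>k \<in> {1..K}\<close> by simp
      ultimately have "g (c, k) \<in> ?B (c, k)" by blast
      then show "g (c, k) = 0" by simp
    next
      fix p assume "(\<forall>p\<in>?I. g p \<in> {..<M}) \<and> (\<forall>k\<in>{1..K}. g (c, k) = 0)" "p \<in> ?I"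
      then show "g p \<in> ?B p" by (cases p) auto
    qed
    then show "g \<in> {g\<in>?I \<rightarrow>\<^sub>E {..<M}. \<forall>k\<in>{1..K}. g (c, k) = 0} \<longleftrightarrow> g \<in> PiE ?I ?B"
      by (simp add: PiE_iff conj_commute conj_left_commute)
  qed
  have "card (PiE ?I ?B) = (\<Prod>p\<in>?I. card (?B p))"
    by (rule card_PiE) simp
  also have "\<dots> = (\<Prod>c'<\<eta>. \<Prod>k\<in>{1..K}. card (?B (c', k)))"
    unfolding prod.cartesian_product by (rule prod.cong) auto
  also have "\<dots> = (\<Prod>c'<\<eta>. if c' = c then 1 else M ^ K)"
    by (intro prod.cong) auto
  also have "\<dots> = (\<Prod>c'\<in>{..<\<eta>} - {c}. M ^ K)"
    by (rule prod.mono_neutral_cong_right) auto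
  also have "\<dots> = (M ^ K) ^ (\<eta> - 1)"
    using assms by simp
  finally have "M ^ K * card (PiE ?I ?B) = (M ^ K) ^ Suc (\<eta> - 1)" by simp
  also have "\<dots> = card (?I \<rightarrow>\<^sub>E {..<M})"
    using assms by (simp add: card_PiE card_cartesian_product mult.commute flip: power_mult)
  finally show ?thesis unfolding eq .
qed

section \<open>The code of a storage design array\<close>

lemma card_div_pred:
  fixes J R :: nat
  shows "card {t\<in>{..<J * R}. p (t div R)} = card {j\<in>{..<J}. p j} * R"
proof -
  have "bij_betw (\<lambda>t. (t div R, t mod R)) {t\<in>{..<J * R}. p (t div R)} ({j\<in>{..<J}. p j} \<times> {..<R})"
  proof (rule bij_betw_byWitness[where f' = "\<lambda>(j, r). j * R + r"])
    show "(\<lambda>t. (t div R, t mod R)) ` {t\<in>{..<J * R}. p (t div R)} \<subseteq> {j\<in>{..<J}. p j} \<times> {..<R}"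
      by (auto simp: less_mult_imp_div_less intro!: mod_less_divisor gr0I)
    show "(\<lambda>(j, r). j * R + r) ` ({j\<in>{..<J}. p j} \<times> {..<R}) \<subseteq> {t\<in>{..<J * R}. p (t div R)}"
      by (auto simp: mult_add_less)
  qed auto
  then show ?thesis
    by (simp add: bij_betw_same_card card_cartesian_product)
qed

text \<open>Guarantees that some position \<open>p\<close> in a class asks for any given residue of
  the desired file.\<close>

lemma add_mod_surj:
  fixes x r M :: nat
  assumes "x < M" "r < M"
  obtains p where "p < M" "(x + p) mod M = r"
proof
  \<comment> \<open>The offset is \<open>r - x\<close> modulo \<open>M\<close>; adding
    \<open>M\<close> first keeps the subtraction from being truncated.\<close>
  show "(r + M - x) mod M < M" using assms by simp
  have "(x + (r + M - x) mod M) mod M = (x + (r + M - x)) mod M" by (rule mod_add_right_eq)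
  also have "\<dots> = r" using assms by simp
  finally show "(x + (r + M - x) mod M) mod M = r" .
qed

lemma add_mod_inj:
  fixes x y a M :: nat
  assumes "x < M" "y < M" "(x + a) mod M = (y + a) mod M"
  shows "x = y"
proof -
  \<comment> \<open>If \<open>x < y\<close>, then \<open>M\<close> would divide
    \<open>y - x\<close>, a positive number below \<open>M\<close>. Equality follows by exchanging
    the two numbers.\<close>
  have le: "y \<le> x" if "x < M" "y < M" "(x + a) mod M = (y + a) mod M" for x y
  proof (rule ccontr)
    assume "\<not> y \<le> x"
    then have "M dvd y - x"
      using that(3) mod_eq_dvd_iff_nat[of "x + a" "y + a" M] by auto
    then show False using that \<open>\<not> y \<le> x\<close> by (auto dest: dvd_imp_le)
  qed
  from le[OF assms] le[OF assms(2,1) assms(3)[symmetric]] show ?thesis by simp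
qed

text \<open>\<open>J\<close> is the number of columns of the array, \<open>idx j\<close> the class of equal columns to which
  column \<open>j\<close> belongs (columns and classes are numbered from 0), \<open>srv c\<close> the set of starred rows of class
  \<open>c\<close>, and \<open>pos c\<close> an enumeration of it. The sample space is identified by \<open>h\<close> with the pairs of a
  tuple of files and a key.\<close>

locale sda_code =
  fixes N K M J \<eta> :: nat and idx :: "nat \<Rightarrow> nat" and srv :: "nat \<Rightarrow> nat set"
    and pos :: "nat \<Rightarrow> nat \<Rightarrow> nat"
    and T :: "nat set" and h :: "nat \<Rightarrow> (nat \<Rightarrow> 'f::{finite,field} list) \<times> (nat \<times> nat \<Rightarrow> nat)"
  assumes N_pos: "1 \<le> N" and K_pos: "1 \<le> K" and M_ge: "2 \<le> M" and J_pos: "1 \<le> J"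
    and idx: "idx ` {..<J} = {..<\<eta>}"
    and srv: "\<And>c. c < \<eta> \<Longrightarrow> srv c \<subseteq> {1..N}"
    and pos: "\<And>c. c < \<eta> \<Longrightarrow> bij_betw (pos c) (srv c) {..<M}"
    and load: "\<And>n. n \<in> {1..N} \<Longrightarrow> card {j\<in>{..<J}. n \<in> srv (idx j)} * N = M * J"
    and h: "bij_betw h T (({1..K} \<rightarrow>\<^sub>E vecs (J * (M - 1))) \<times> (({..<\<eta>} \<times> {1..K}) \<rightarrow>\<^sub>E {..<M}))"
begin

section \<open>Packets, storage, queries and answers of the code\<close>

definition "R = M - 1"
definition "L = J * R"

abbreviation files :: "(nat \<Rightarrow> 'f list) set" where
  "files \<equiv> {1..K} \<rightarrow>\<^sub>E vecs L"

abbreviation "I \<equiv> {..<\<eta>} \<times> {1..K}"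

abbreviation keys :: "(nat \<times> nat \<Rightarrow> nat) set" where
  "keys \<equiv> I \<rightarrow>\<^sub>E {..<M}"

definition W :: "nat \<Rightarrow> nat \<Rightarrow> 'f list" where
  "W k \<omega> = fst (h \<omega>) k"

text \<open>Packet \<open>c * R + r + 1\<close> collects row \<open>r\<close> of all columns of class \<open>c\<close>, so that a class
  has weight proportional to its multiplicity in the array.\<close>

definition part :: "nat \<Rightarrow> nat \<Rightarrow> nat set" where
  "part k i = {t\<in>{..<L}. Suc (idx (t div R) * R + t mod R) = i}"

text \<open>Inverts the numbering of packets: packet \<open>i\<close> belongs to class
  \<open>(i - 1) div R\<close>.\<close>

definition Zset :: "nat \<Rightarrow> nat set" where
  "Zset n = {i\<in>{1..\<eta> * R}. n \<in> srv ((i - 1) div R)}"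

text \<open>For a server outside class \<open>c\<close> the value \<open>pos c n\<close> is
  arbitrary. It still only rotates the entry, and \<open>mask\<close> erases the entry
  afterwards.\<close>

definition shift :: "nat \<Rightarrow> nat \<Rightarrow> (nat \<times> nat \<Rightarrow> nat) \<Rightarrow> nat \<times> nat \<Rightarrow> nat" where
  "shift \<theta> n g = (\<lambda>(c, k)\<in>I. (g (c, k) + (if k = \<theta> then pos c n else 0)) mod M)"

definition mask :: "nat \<Rightarrow> (nat \<times> nat \<Rightarrow> nat) \<Rightarrow> nat \<times> nat \<Rightarrow> nat" where
  "mask n g = (\<lambda>(c, k)\<in>I. if n \<in> srv c then g (c, k) else 0)"

text \<open>Shifting the uniform key at the desired file \<open>\<theta>\<close> is a bijection of the key space: a single
  server cannot see \<open>\<theta>\<close>, while the servers of one class together see every row of \<open>\<theta>\<close>.\<close>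

definition query :: "nat \<Rightarrow> nat \<Rightarrow> (nat \<times> nat \<Rightarrow> nat) \<Rightarrow> nat \<times> nat \<Rightarrow> nat" where
  "query \<theta> n g = mask n (shift \<theta> n g)"

text \<open>Queries are sent as natural numbers through a numbering of the finite key space, which
  gives them a concrete type without losing information.\<close>

definition Q :: "nat \<Rightarrow> nat \<Rightarrow> nat \<Rightarrow> nat" where
  "Q \<theta> n \<omega> = to_nat_on keys (query \<theta> n (snd (h \<omega>)))"

text \<open>Linear combinations are numbered from 1 and classes from 0, whence \<open>j - 1\<close>.
  A nonzero residue \<open>v\<close> selects packet \<open>c * R + v\<close>, which is row
  \<open>v - 1\<close> of class \<open>c\<close>; residue 0 selects no packet.\<close>

definition coef :: "(nat \<times> nat \<Rightarrow> nat) \<Rightarrow> nat \<Rightarrow> nat \<Rightarrow> nat \<Rightarrow> 'f" where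
  "coef v k i j = (if v (j - 1, k) \<noteq> 0 \<and> i = (j - 1) * R + v (j - 1, k) then 1 else 0)"

text \<open>For the query 0, and for classes that the server does not store, an entry of the reply is
  the zero vector, which contributes nothing to the download cost because it is determined by the query.\<close>

definition reply :: "nat \<Rightarrow> (nat \<times> nat \<Rightarrow> nat) \<Rightarrow> (nat \<Rightarrow> 'f list) \<Rightarrow> 'f list list" where
  "reply n v w = map (\<lambda>j. padded_sum (\<lambda>(k, i). map ((*) (coef v k i j)) (nths (w k) (part k i)))
      ({1..K} \<times> Zset n)) [1..<Suc \<eta>]"

definition A :: "nat \<Rightarrow> nat \<Rightarrow> nat \<Rightarrow> 'f list list" where
  "A \<theta> n \<omega> = reply n (query \<theta> n (snd (h \<omega>))) (fst (h \<omega>))"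

text \<open>Isolates what the analysis of a reply needs of a query: every packet asked for is stored
  at the server.\<close>

definition admissible :: "nat \<Rightarrow> (nat \<times> nat \<Rightarrow> nat) \<Rightarrow> bool" where
  "admissible n v \<longleftrightarrow> v \<in> keys \<and> (\<forall>c<\<eta>. \<forall>k\<in>{1..K}. v (c, k) \<noteq> 0 \<longrightarrow> n \<in> srv c)"

section \<open>Keys and queries\<close>

lemma R_pos: "1 \<le> R" and Suc_R: "Suc R = M"
  using M_ge by (simp_all add: R_def)

lemma bij_h: "bij_betw h T (files \<times> keys)"
  using h by (simp add: L_def R_def)

lemma idx_less: "j < J \<Longrightarrow> idx j < \<eta>"
  using idx by blast

lemma finite_files: "finite files" and finite_keys: "finite keys"
  by (auto intro!: finite_PiE simp: finite_vecs)

lemma keys_less: "v \<in> keys \<Longrightarrow> c < \<eta> \<Longrightarrow> k \<in> {1..K} \<Longrightarrow> v (c, k) < M"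
  by (auto simp: PiE_iff)

lemma shift_apply: "c < \<eta> \<Longrightarrow> k \<in> {1..K} \<Longrightarrow>
    shift \<theta> n g (c, k) = (g (c, k) + (if k = \<theta> then pos c n else 0)) mod M"
  by (simp add: shift_def)

lemma shift_in_keys: "shift \<theta> n g \<in> keys"
  using M_ge by (auto simp: shift_def)

text \<open>Adding a constant modulo \<open>M\<close> is injective in each entry, and an injective
  self-map of a finite set is onto.\<close>

lemma bij_shift: "bij_betw (shift \<theta> n) keys keys"
proof -
  have inj: "inj_on (shift \<theta> n) keys"
  proof (rule inj_onI)
    fix g g' assume g: "g \<in> keys" "g' \<in> keys" and eq: "shift \<theta> n g = shift \<theta> n g'"
    show "g = g'"
    proof (rule PiE_ext[OF g])
      fix p assume "p \<in> I"
      then obtain c k where p: "p = (c, k)" "c < \<eta>" "k \<in> {1..K}" by blast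
      have "shift \<theta> n g (c, k) = shift \<theta> n g' (c, k)" using eq by simp
      then show "g p = g' p"
        unfolding shift_apply[OF p(2,3)] p(1)
        by (rule add_mod_inj[OF keys_less[OF g(1) p(2,3)] keys_less[OF g(2) p(2,3)]])
    qed
  qed
  have "shift \<theta> n ` keys \<subseteq> keys" using shift_in_keys by blast
  then show ?thesis
    using inj finite_keys by (simp add: bij_betw_def endo_inj_surj)
qed

lemma query_apply: "c < \<eta> \<Longrightarrow> k \<in> {1..K} \<Longrightarrow>
    query \<theta> n g (c, k) =
      (if n \<in> srv c then (g (c, k) + (if k = \<theta> then pos c n else 0)) mod M else 0)"
  by (simp add: query_def mask_def shift_apply)

lemma admissible_query: "admissible n (query \<theta> n g)"
  using M_ge by (auto simp: admissible_def query_def mask_def shift_def split: if_splits)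

lemma query_in_keys: "query \<theta> n g \<in> keys"
  using admissible_query by (auto simp: admissible_def)

text \<open>The number received determines the query, so coefficients may be written as functions of
  that number.\<close>

lemma decode_Q: "from_nat_into keys (Q \<theta> n \<omega>) = query \<theta> n (snd (h \<omega>))"
  unfolding Q_def by (rule from_nat_into_to_nat_on[OF countable_finite[OF finite_keys] query_in_keys])

lemma Q_eq_iff: "Q \<theta> n \<omega> = Q \<theta> n \<omega>' \<longleftrightarrow> query \<theta> n (snd (h \<omega>)) = query \<theta> n (snd (h \<omega>'))"
  by (metis Q_def decode_Q)

section \<open>Packets, replies and decoding\<close>

lemma part_mem:
  assumes "r < R"
  shows "t \<in> part k (Suc (c * R + r)) \<longleftrightarrow> t < L \<and> idx (t div R) = c \<and> t mod R = r"
proof -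
  have "a * R + s = c * R + r \<longleftrightarrow> a = c \<and> s = r" if "s < R" for a s
  proof
    assume eq: "a * R + s = c * R + r"
    have "a = (a * R + s) div R" "c = (c * R + r) div R" using that assms by simp_all
    then have "a = c" using eq by simp
    then show "a = c \<and> s = r" using eq by simp
  qed simp
  moreover have "t mod R < R" using R_pos by simp
  ultimately show ?thesis by (auto simp: part_def)
qed

text \<open>Its length is the dimension of every packet of class \<open>c\<close>, and its order is
  the order of the coordinates within such a packet.\<close>

definition cls :: "nat \<Rightarrow> nat list" where
  "cls c = filter (\<lambda>j. idx j = c) [0..<J]"

lemma nths_part:
  assumes "r < R" "length xs = L"
  shows "nths xs (part k (Suc (c * R + r))) = map (\<lambda>j. xs ! (j * R + r)) (cls c)"
proof -
  have "nths xs (part k (Suc (c * R + r))) =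
      map ((!) xs) (filter (\<lambda>t. idx (t div R) = c \<and> t mod R = r) [0..<J * R])"
    unfolding nths_eq_map_filter assms(2)
    by (rule arg_cong[where f = "map _"]) (auto intro!: filter_cong simp: part_mem[OF assms(1)] L_def)
  also have "\<dots> = map (\<lambda>j. xs ! (j * R + r)) (cls c)"
    unfolding filter_div_mod[OF assms(1), of "\<lambda>j. idx j = c"] cls_def by simp
  finally show ?thesis .
qed

lemma length_nths_part: "length xs = L \<Longrightarrow> length (nths xs (part k i)) = card (part k i)"
  by (auto simp: length_nths part_def intro!: arg_cong[where f = card])

text \<open>The size of a packet depends on positions only, so it can be read off from a constant
  list of length \<open>L\<close>.\<close>

lemma card_part: "r < R \<Longrightarrow> card (part k (Suc (c * R + r))) = length (cls c)"
  using nths_part[of r "replicate L (0 :: nat)"] length_nths_part[of "replicate L (0 :: nat)"]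
  by (metis length_map length_replicate)

lemma length_file: "w \<in> files \<Longrightarrow> k \<in> {1..K} \<Longrightarrow> length (w k) = L"
  by (auto simp: vecs_def PiE_iff)

lemma Zset_mem:
  assumes "r < R" "c < \<eta>" "n \<in> srv c"
  shows "Suc (c * R + r) \<in> Zset n"
  using assms mult_add_less[OF assms(2,1)] by (simp add: Zset_def)

text \<open>The dimension to which a server pads all its linear combinations. Every stored packet
  enters the padded sum, possibly with coefficient 0, so this dimension is the same for all
  queries.\<close>

definition width :: "nat \<Rightarrow> nat" where
  "width n = Max (insert 0 ((\<lambda>(k, i). card (part k i)) ` ({1..K} \<times> Zset n)))"

lemma finite_Zset: "finite (Zset n)"
  by (simp add: Zset_def)

lemma width_ge:
  assumes "c < \<eta>" "n \<in> srv c"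
  shows "length (cls c) \<le> width n"
proof -
  have r: "0 < R" using R_pos by simp
  \<comment> \<open>All packets of a class have equal size; file 1 and row 0 are representatives
    that exist since \<open>K\<close> and \<open>R\<close> are positive.\<close>
  have "card (part 1 (Suc (c * R + 0))) \<in> (\<lambda>(k, i). card (part k i)) ` ({1..K} \<times> Zset n)"
    by (rule image_eqI[of _ _ "(1, Suc (c * R + 0))"])
      (use K_pos Zset_mem[OF r assms] in auto)
  then show ?thesis
    unfolding width_def card_part[OF r] by (intro Max_ge) (auto simp: finite_Zset)
qed

text \<open>For each file the coefficients single out at most one packet, and coordinate
  \<open>t\<close> of that packet comes from the \<open>t\<close>-th column of the class. Beyond the
  multiplicity of the class only padding remains.\<close>

lemma reply_entry:
  assumes w: "w \<in> files" and v: "admissible n v" and c: "c < \<eta>"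
  shows "reply n v w ! c =
    map (\<lambda>t. if t < length (cls c) then column_answer K R idx v w (cls c ! t) else 0) [0..<width n]"
proof -
  let ?p = "\<lambda>(k, i). map ((*) (coef v k i (Suc c))) (nths (w k) (part k i))"
  have "reply n v w ! c = padded_sum ?p ({1..K} \<times> Zset n)"
    using c by (simp add: reply_def nth_map_upt del: upt_Suc)
  also have "\<dots> = map (\<lambda>t. \<Sum>x\<in>{1..K} \<times> Zset n. nth_default 0 (?p x) t) [0..<width n]"
  proof -
    have "(\<lambda>x. length (?p x)) ` ({1..K} \<times> Zset n) = (\<lambda>(k, i). card (part k i)) ` ({1..K} \<times> Zset n)"
      by (rule image_cong) (auto simp: length_nths_part length_file[OF w])
    then show ?thesis by (simp add: padded_sum_def width_def)
  qed
  also have "\<dots> = map (\<lambda>t. if t < length (cls c) then column_answer K R idx v w (cls c ! t) else 0)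
      [0..<width n]"
  proof (rule map_cong[OF refl])
    fix t
    let ?d = "\<lambda>k. if v (c, k) = 0 then 0
        else if t < length (cls c) then w k ! (cls c ! t * R + (v (c, k) - 1)) else 0"
    have "(\<Sum>x\<in>{1..K} \<times> Zset n. nth_default 0 (?p x) t) =
        (\<Sum>k=1..K. \<Sum>i\<in>Zset n. nth_default 0 (?p (k, i)) t)"
      by (simp add: sum.cartesian_product case_prod_beta)
    also have "\<dots> = (\<Sum>k=1..K. ?d k)"
    proof (rule sum.cong[OF refl])
      fix k assume k: "k \<in> {1..K}"
      have nz: "nth_default 0 (?p (k, i)) t = coef v k i (Suc c) * nth_default 0 (nths (w k) (part k i)) t" for i
        by (simp add: nth_default_def)
      show "(\<Sum>i\<in>Zset n. nth_default 0 (?p (k, i)) t) = ?d k"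
      proof (cases "v (c, k) = 0")
        case True
        then show ?thesis unfolding nz by (simp add: coef_def)
      next
        case False
        \<comment> \<open>The residues \<open>1\<close> to \<open>R\<close> stand for the rows
          \<open>0\<close> to \<open>R - 1\<close>.\<close>
        define r where "r = v (c, k) - 1"
        have r: "r < R" "c * R + v (c, k) = Suc (c * R + r)"
          using keys_less[of v c k] v c k False Suc_R by (auto simp: admissible_def r_def)
        have "n \<in> srv c" using v c k False by (auto simp: admissible_def)
        then have mem: "Suc (c * R + r) \<in> Zset n" by (rule Zset_mem[OF r(1) c])
        have "(\<Sum>i\<in>Zset n. nth_default 0 (?p (k, i)) t) =
            (\<Sum>i\<in>Zset n. if i = Suc (c * R + r) then nth_default 0 (nths (w k) (part k i)) t else 0)"
          unfolding nz using False r(2) by (intro sum.cong) (auto simp: coef_def)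
        also have "\<dots> = nth_default 0 (nths (w k) (part k (Suc (c * R + r)))) t"
          using mem finite_Zset by simp
        also have "\<dots> = ?d k"
          unfolding nths_part[OF r(1) length_file[OF w k]] using False
          by (simp add: nth_default_def r_def)
        finally show ?thesis .
      qed
    qed
    also have "\<dots> = (if t < length (cls c) then column_answer K R idx v w (cls c ! t) else 0)"
    proof (cases "t < length (cls c)")
      case True
      then have "idx (cls c ! t) = c" using nth_mem[OF True] by (simp add: cls_def)
      then show ?thesis using True by (simp add: column_answer_def cong: if_cong)
    qed (auto intro!: sum.neutral)
    finally show "(\<Sum>x\<in>{1..K} \<times> Zset n. nth_default 0 (?p x) t) =
        (if t < length (cls c) then column_answer K R idx v w (cls c ! t) else 0)" .
  qed
  finally show ?thesis .
qed

lemma length_reply: "length (reply n v w) = \<eta>"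
  by (simp add: reply_def)

text \<open>The reply and the list of column answers determine each other. An active column lies in
  a stored class and hence appears uncut in the reply; an inactive column answers 0 for all
  files.\<close>

lemma reply_eq_iff:
  assumes w: "w \<in> files" "w' \<in> files" and v: "admissible n v"
  shows "reply n v w = reply n v w' \<longleftrightarrow>
    (\<forall>j<J. column_answer K R idx v w j = column_answer K R idx v w' j)"
proof
  assume eq: "reply n v w = reply n v w'"
  show "\<forall>j<J. column_answer K R idx v w j = column_answer K R idx v w' j"
  proof (intro allI impI)
    fix j assume j: "j < J"
    show "column_answer K R idx v w j = column_answer K R idx v w' j"
    proof (cases "j \<in> active J K idx v")
      case False
      then show ?thesis using j by (simp add: column_answer_inactive)
    next
      case True
      have "n \<in> srv (idx j)"
        using True v idx_less[OF j] by (auto simp: active_def admissible_def)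
      then have le: "length (cls (idx j)) \<le> width n" by (rule width_ge[OF idx_less[OF j]])
      have "j \<in> set (cls (idx j))" using j by (simp add: cls_def)
      then obtain t where t: "t < length (cls (idx j))" "cls (idx j) ! t = j"
        by (auto simp: in_set_conv_nth)
      have "reply n v w ! idx j ! t = reply n v w' ! idx j ! t" using eq by simp
      then show ?thesis
        using t le by (simp add: reply_entry[OF w(1) v idx_less[OF j]] reply_entry[OF w(2) v idx_less[OF j]])
    qed
  qed
next
  assume eq: "\<forall>j<J. column_answer K R idx v w j = column_answer K R idx v w' j"
  show "reply n v w = reply n v w'"
  proof (rule nth_equalityI)
    fix c assume "c < length (reply n v w)"
    then have c: "c < \<eta>" by (simp add: length_reply)
    have "cls c ! t < J" if "t < length (cls c)" for t
      using nth_mem[OF that] by (simp add: cls_def)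
    then show "reply n v w ! c = reply n v w' ! c"
      unfolding reply_entry[OF w(1) v c] reply_entry[OF w(2) v c] using eq by simp
  qed (simp add: length_reply)
qed

text \<open>In the class of a coordinate of file \<theta>, one server is asked for its row and
  another for nothing of \<theta>. Their queries agree at all other files, so the difference of
  their answers is that coordinate.\<close>

lemma decode:
  assumes \<theta>: "\<theta> \<in> {1..K}" and w: "w \<in> files" "w' \<in> files" and g: "g \<in> keys" "g' \<in> keys"
    and q: "\<And>n. n \<in> {1..N} \<Longrightarrow> query \<theta> n g = query \<theta> n g'"
    and a: "\<And>n. n \<in> {1..N} \<Longrightarrow> reply n (query \<theta> n g) w = reply n (query \<theta> n g') w'"
  shows "w \<theta> = w' \<theta>"
proof (rule nth_equalityI)
  show "length (w \<theta>) = length (w' \<theta>)" by (simp add: length_file[OF w(1) \<theta>] length_file[OF w(2) \<theta>])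
  fix t assume "t < length (w \<theta>)"
  then have t: "t < J * R" by (simp add: length_file[OF w(1) \<theta>] L_def)
  define j where "j = t div R"
  define s where "s = t mod R"
  have j: "j < J" using t by (simp add: j_def less_mult_imp_div_less)
  have "s < R" using R_pos by (simp add: s_def)
  then have s: "Suc s < M" using Suc_R by linarith
  have ts: "t = j * R + s" by (simp add: j_def s_def)
  note c = idx_less[OF j]
  have server: "\<exists>n\<in>srv (idx j). query \<theta> n g (idx j, \<theta>) = r" if r: "r < M" for r
  proof -
    obtain p where p: "p < M" "(g (idx j, \<theta>) + p) mod M = r"
      by (rule add_mod_surj[OF keys_less[OF g(1) c \<theta>] r])
    then obtain n where "n \<in> srv (idx j)" "pos (idx j) n = p"
      using pos[OF c] by (metis bij_betw_imp_surj_on imageE lessThan_iff)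
    then show ?thesis using p by (auto simp: query_apply[OF c \<theta>])
  qed
  \<comment> \<open>Row \<open>s\<close> is requested by residue \<open>Suc s\<close>, since residue
    0 is reserved for the empty request.\<close>
  obtain n where n: "n \<in> srv (idx j)" "query \<theta> n g (idx j, \<theta>) = Suc s" using server[OF s] by blast
  obtain m where m: "m \<in> srv (idx j)" "query \<theta> m g (idx j, \<theta>) = 0" using server[of 0] M_ge by auto
  have same: "column_answer K R idx (query \<theta> l g) w j = column_answer K R idx (query \<theta> l g) w' j"
    if "l \<in> srv (idx j)" for l
  proof -
    have l: "l \<in> {1..N}" using that srv[OF c] by blast
    have "reply l (query \<theta> l g) w = reply l (query \<theta> l g) w'" using a[OF l] by (simp add: q[OF l])
    then show ?thesis using j by (simp add: reply_eq_iff[OF w admissible_query])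
  qed
  \<comment> \<open>The interference of the other files is the same for both servers, because only
    the residue of \<theta> depends on the server.\<close>
  have diff: "u \<theta> ! t = column_answer K R idx (query \<theta> n g) u j - column_answer K R idx (query \<theta> m g) u j"
    for u :: "nat \<Rightarrow> 'f list"
  proof -
    let ?x = "\<lambda>l k. if query \<theta> l g (idx j, k) = 0 then 0 else u k ! (j * R + (query \<theta> l g (idx j, k) - 1))"
    have split: "column_answer K R idx (query \<theta> l g) u j = ?x l \<theta> + (\<Sum>k\<in>{1..K} - {\<theta>}. ?x l k)" for l
      unfolding column_answer_def by (rule sum.remove) (use \<theta> in auto)
    have "(\<Sum>k\<in>{1..K} - {\<theta>}. ?x n k) = (\<Sum>k\<in>{1..K} - {\<theta>}. ?x m k)"
      by (rule sum.cong[OF refl]) (use n(1) m(1) c in \<open>simp add: query_apply\<close>)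
    then show ?thesis
      unfolding split using n(2) m(2) by (simp add: ts)
  qed
  show "w \<theta> ! t = w' \<theta> ! t"
    unfolding diff by (simp add: same n(1) m(1))
qed

section \<open>The sample space of files and keys\<close>

sublocale finite_uniform T "real CARD('f)"
proof
  have "finite (files \<times> keys)" using finite_files finite_keys by simp
  then show "finite T" using bij_h bij_betw_finite by blast
  have "(\<lambda>k\<in>{1..K}. replicate L 0, \<lambda>p\<in>I. 0) \<in> files \<times> keys"
    using M_ge by (auto simp: vecs_def)
  moreover have "h ` T = files \<times> keys" using bij_h by (rule bij_betw_imp_surj_on)
  ultimately show "T \<noteq> {}" by blast
  have "card {0, 1 :: 'f} \<le> CARD('f)" by (rule card_mono) auto
  then show "1 < real CARD('f)" by simp
qed

lemma h_mem: "\<omega> \<in> T \<Longrightarrow> fst (h \<omega>) \<in> files" "\<omega> \<in> T \<Longrightarrow> snd (h \<omega>) \<in> keys"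
  using bij_betwE[OF bij_h] by (auto simp only: mem_Times_iff)

text \<open>The sample space is a product, so conditions on the files and on the key are counted
  separately. All independence claims reduce to this.\<close>

lemma card_event:
  "card {\<omega>\<in>T. p (fst (h \<omega>)) \<and> r (snd (h \<omega>))} = card {w\<in>files. p w} * card {g\<in>keys. r g}"
proof -
  have "bij_betw h {\<omega>\<in>T. p (fst (h \<omega>)) \<and> r (snd (h \<omega>))} ({w\<in>files. p w} \<times> {g\<in>keys. r g})"
  proof (rule bij_betw_subset[OF bij_h])
    have "h ` {\<omega>\<in>T. p (fst (h \<omega>)) \<and> r (snd (h \<omega>))} = {s\<in>h ` T. p (fst s) \<and> r (snd s)}" by blast
    also have "h ` T = files \<times> keys" using bij_h by (rule bij_betw_imp_surj_on)
    also have "{s\<in>X \<times> Y. p (fst s) \<and> r (snd s)} = {w\<in>X. p w} \<times> {g\<in>Y. r g}" for X Y by auto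
    finally show "h ` {\<omega>\<in>T. p (fst (h \<omega>)) \<and> r (snd (h \<omega>))} = {w\<in>files. p w} \<times> {g\<in>keys. r g}" .
  qed blast
  then show ?thesis by (simp add: bij_betw_same_card card_cartesian_product)
qed

lemma card_event_files: "card {\<omega>\<in>T. p (fst (h \<omega>))} = card {w\<in>files. p w} * card keys"
  and card_event_keys: "card {\<omega>\<in>T. r (snd (h \<omega>))} = card files * card {g\<in>keys. r g}"
  and card_T: "card T = card files * card keys"
  using card_event[of p "\<lambda>_. True"] card_event[of "\<lambda>_. True" r] card_event[of "\<lambda>_. True" "\<lambda>_. True"]
  by simp_all

lemma cards_pos: "0 < card files" "0 < card keys"
  using card_T card_T_pos by auto

lemma sum_keys:
  fixes f :: "_ \<Rightarrow> real"
  shows "(\<Sum>\<omega>\<in>T. f (snd (h \<omega>))) = card files * (\<Sum>g\<in>keys. f g)"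
proof -
  have "(\<Sum>\<omega>\<in>T. f (snd (h \<omega>))) = (\<Sum>s\<in>files \<times> keys. f (snd s))"
    by (rule sum.reindex_bij_betw[OF bij_h])
  also have "\<dots> = (\<Sum>w\<in>files. \<Sum>g\<in>keys. f g)"
    unfolding sum.cartesian_product by (simp only: split_def)
  finally show ?thesis by simp
qed

section \<open>Distribution of the files\<close>

lemma prob_files:
  assumes "\<And>k. k \<in> {1..K} \<Longrightarrow> B k \<subseteq> vecs L"
  shows "card {\<omega>\<in>T. \<forall>k\<in>{1..K}. W k \<omega> \<in> B k} / card T = (\<Prod>k=1..K. card (B k) / CARD('f) ^ L)"
proof -
  have "{w\<in>files. \<forall>k\<in>{1..K}. w k \<in> B k} = PiE {1..K} B"
    using assms by (intro set_eqI, unfold mem_Collect_eq PiE_iff) blast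
  then have "card {\<omega>\<in>T. \<forall>k\<in>{1..K}. W k \<omega> \<in> B k} = (\<Prod>k=1..K. card (B k)) * card keys"
    using card_event_files[of "\<lambda>w. \<forall>k\<in>{1..K}. w k \<in> B k"] by (simp add: W_def card_PiE)
  moreover have "card files = (\<Prod>k=1..K. CARD('f) ^ L)"
    by (simp add: card_PiE card_vecs)
  ultimately show ?thesis
    using cards_pos by (simp add: card_T prod_dividef)
qed

lemma prob_file:
  assumes k: "k \<in> {1..K}" and B: "B \<subseteq> vecs L"
  shows "card {\<omega>\<in>T. W k \<omega> \<in> B} / card T = card B / CARD('f) ^ L"
proof -
  \<comment> \<open>The marginal law arises by leaving all other files unrestricted.\<close>
  let ?B = "\<lambda>k'. if k' = k then B else vecs L"
  have "{\<omega>\<in>T. W k \<omega> \<in> B} = {\<omega>\<in>T. \<forall>k'\<in>{1..K}. W k' \<omega> \<in> ?B k'}"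
    using k h_mem(1) by (auto simp: W_def PiE_iff)
  then have "card {\<omega>\<in>T. W k \<omega> \<in> B} / card T = (\<Prod>k'=1..K. card (?B k') / CARD('f) ^ L)"
    using prob_files[of ?B] B by simp
  also have "\<dots> = card (?B k) / CARD('f) ^ L * (\<Prod>k'\<in>{1..K} - {k}. card (?B k') / CARD('f) ^ L)"
    using k by (intro prod.remove) auto
  also have "(\<Prod>k'\<in>{1..K} - {k}. card (?B k') / CARD('f) ^ L) = 1"
    by (rule prod.neutral) (auto simp: card_vecs)
  finally show ?thesis by simp
qed

lemma W_in_vecs: "k \<in> {1..K} \<Longrightarrow> \<omega> \<in> T \<Longrightarrow> W k \<omega> \<in> vecs L"
  using h_mem(1) by (auto simp: W_def PiE_iff)

lemma W_image: "k \<in> {1..K} \<Longrightarrow> W k ` T = vecs L"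
proof
  assume k: "k \<in> {1..K}"
  then show "W k ` T \<subseteq> vecs L" using W_in_vecs by blast
  show "vecs L \<subseteq> W k ` T"
  proof
    fix x :: "'f list" assume x: "x \<in> vecs L"
    then have "card {\<omega>\<in>T. W k \<omega> \<in> {x}} / card T = 1 / CARD('f) ^ L"
      using prob_file[OF k, of "{x}"] by simp
    then have "card {\<omega>\<in>T. W k \<omega> \<in> {x}} \<noteq> 0" by (intro notI) simp
    then have "{\<omega>\<in>T. W k \<omega> \<in> {x}} \<noteq> {}" by (metis card.empty)
    then show "x \<in> W k ` T" by blast
  qed
qed

lemma W_indep: "indep_vars (\<lambda>_. count_space (vecs L)) W {1..K}"
proof (rule indep_vars_by_counting)
  show "{1..K} \<noteq> {}" using K_pos by simp
  show "W k \<omega> \<in> vecs L" if "k \<in> {1..K}" "\<omega> \<in> T" for k \<omega>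
    using that by (rule W_in_vecs)
  fix B :: "nat \<Rightarrow> 'f list set" assume B: "\<And>k. k \<in> {1..K} \<Longrightarrow> B k \<subseteq> vecs L"
  show "card {\<omega>\<in>T. \<forall>i\<in>{1..K}. W i \<omega> \<in> B i} / card T =
      (\<Prod>i\<in>{1..K}. card {\<omega>\<in>T. W i \<omega> \<in> B i} / card T)"
    by (subst prob_files, erule B, rule prod.cong[OF refl], subst prob_file, assumption, erule B, rule refl)
qed simp

lemma W_uniform:
  assumes k: "k \<in> {1..K}"
  shows "distr U (count_space (vecs L)) (W k) = uniform_count_measure (vecs L)"
proof (rule measure_eqI)
  show "sets (distr U (count_space (vecs L)) (W k)) = sets (uniform_count_measure (vecs L))"
    by (simp add: sets_uniform_count_measure)
  fix B assume "B \<in> sets (distr U (count_space (vecs L)) (W k))"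
  then have B: "B \<subseteq> vecs L" by simp
  have "emeasure (distr U (count_space (vecs L)) (W k)) B = emeasure U {\<omega>\<in>T. W k \<omega> \<in> B}"
    using W_in_vecs[OF k] B
    by (subst emeasure_distr)
       (auto simp: measurable_def space_U sets_uniform_count_measure intro!: arg_cong2[where f = emeasure])
  also have "\<dots> = ennreal (card {\<omega>\<in>T. W k \<omega> \<in> B} / card T)"
    by (rule emeasure_uniform_count_measure[OF finite_T]) auto
  also have "\<dots> = ennreal (card B / card (vecs L :: 'f list set))"
    by (simp add: prob_file[OF k B] card_vecs)
  also have "\<dots> = emeasure (uniform_count_measure (vecs L)) B"
    by (rule emeasure_uniform_count_measure[OF finite_vecs B, symmetric])
  finally show "emeasure (distr U (count_space (vecs L)) (W k)) B =
      emeasure (uniform_count_measure (vecs L)) B" .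
qed

section \<open>Sub-packetization and storage\<close>

lemma sc_pir_files: "sc_pir_files U (real CARD('f)) K L (\<eta> * R) W part"
proof unfold_locales
  show "1 \<le> K" by (rule K_pos)
  show "1 \<le> L" using J_pos R_pos by (simp add: L_def)
  show "indep_vars (\<lambda>_. count_space (vecs L)) W {1..K}" by (rule W_indep)
  show "distr U (count_space (vecs L)) (W k) = uniform_count_measure (vecs L)" if "k \<in> {1..K}" for k
    using that by (rule W_uniform)
  show "(\<Union>i\<in>{1..\<eta> * R}. part k i) = {..<L}" for k
  proof
    show "(\<Union>i\<in>{1..\<eta> * R}. part k i) \<subseteq> {..<L}" by (auto simp: part_def)
    show "{..<L} \<subseteq> (\<Union>i\<in>{1..\<eta> * R}. part k i)"
    proof
      fix t assume t: "t \<in> {..<L}"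
      then have "idx (t div R) < \<eta>" by (intro idx_less) (simp add: L_def less_mult_imp_div_less)
      moreover have "t mod R < R" using R_pos by simp
      ultimately have "idx (t div R) * R + t mod R < \<eta> * R" by (rule mult_add_less)
      then show "t \<in> (\<Union>i\<in>{1..\<eta> * R}. part k i)"
        using t by (intro UN_I[of "Suc (idx (t div R) * R + t mod R)"]) (auto simp: part_def)
    qed
  qed
  show "disjoint_family_on (part k) {1..\<eta> * R}" for k
    by (auto simp: disjoint_family_on_def part_def)
  show "part k i \<noteq> {}" if "i \<in> {1..\<eta> * R}" for k i
  proof -
    \<comment> \<open>The number of a packet splits into its class and its row. Since
      \<open>idx\<close> is onto, the class contains a column, whose entry in that row lies in the
      packet.\<close>
    have i: "i = Suc ((i - 1) div R * R + (i - 1) mod R)" using that by simp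
    have r: "(i - 1) mod R < R" using R_pos by simp
    have "(i - 1) div R < \<eta>" using that by (intro less_mult_imp_div_less) auto
    then obtain j where j: "j < J" "idx j = (i - 1) div R" using idx by (metis imageE lessThan_iff)
    have "j * R + (i - 1) mod R \<in> part k (Suc ((i - 1) div R * R + (i - 1) mod R))"
      unfolding part_mem[OF r] using r j mult_add_less[OF j(1) r] by (simp add: L_def)
    then show ?thesis unfolding i[symmetric] by blast
  qed
qed simp

text \<open>The packets stored by a server make up all \<open>R\<close> coordinates of exactly the
  columns in which it is starred, and \<open>load\<close> counts these columns.\<close>

lemma Zset_load:
  assumes n: "n \<in> {1..N}"
  shows "(\<Sum>i\<in>Zset n. card (part k i)) * N = M * L"
proof -
  have "(\<Sum>i\<in>Zset n. card (part k i)) = card (\<Union>i\<in>Zset n. part k i)"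
    by (rule card_UN_disjoint[symmetric]) (auto simp: finite_Zset part_def)
  also have "(\<Union>i\<in>Zset n. part k i) = {t\<in>{..<J * R}. n \<in> srv (idx (t div R))}"
  proof -
    have "Suc (idx (t div R) * R + t mod R) \<in> Zset n \<longleftrightarrow> n \<in> srv (idx (t div R))" if "t < J * R" for t
    proof -
      have r: "t mod R < R" using R_pos by simp
      have c: "idx (t div R) < \<eta>" using that by (intro idx_less less_mult_imp_div_less)
      show ?thesis
        using Zset_mem[OF r c] r by (auto simp: Zset_def)
    qed
    then show ?thesis by (auto simp: part_def L_def)
  qed
  also have "card \<dots> = card {j\<in>{..<J}. n \<in> srv (idx j)} * R" by (rule card_div_pred)
  finally show ?thesis using load[OF n] by (simp add: L_def mult.commute mult.left_commute)
qed

lemma sc_pir_storage: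
  "sc_pir_storage U (real CARD('f)) K L (\<eta> * R) W part (real M / real N) N Zset"
proof -
  interpret F: sc_pir_files U "real CARD('f)" K L "\<eta> * R" W part by (rule sc_pir_files)
  show ?thesis
  proof unfold_locales
    show "1 \<le> N" by (rule N_pos)
    fix k k' i assume k: "k \<in> {1..K}" "k' \<in> {1..K}"
    \<comment> \<open>\<open>part\<close> is the same for all files, so a packet is one fixed
      function of identically distributed files; \<open>part 1\<close> is a representative.\<close>
    have eq: "F.packet k i = (\<lambda>x. nths x (part 1 i)) \<circ> W k" for k
      by (auto simp: F.packet_def part_def)
    have "distr U (count_space ((\<lambda>x. nths x (part 1 i)) ` vecs L)) (F.packet k i) =
       distr (uniform_count_measure (vecs L)) (count_space ((\<lambda>x. nths x (part 1 i)) ` vecs L))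
         (\<lambda>x. nths x (part 1 i))" if k: "k \<in> {1..K}" for k
      unfolding eq W_uniform[OF k, symmetric]
      by (rule distr_distr[symmetric])
         (use W_in_vecs[OF k] in \<open>auto simp: measurable_def space_U sets_uniform_count_measure\<close>)
    moreover have "F.packet k i ` space U = (\<lambda>x. nths x (part 1 i)) ` vecs L" if k: "k \<in> {1..K}" for k
      unfolding eq space_U image_comp[symmetric] W_image[OF k] ..
    ultimately show "F.entropy_q (F.packet k i) = F.entropy_q (F.packet k' i)"
      using k by (simp add: entropy_def)
  next
    show "Zset n \<subseteq> {1..\<eta> * R}" for n by (auto simp: Zset_def)
    show "\<exists>n\<in>{1..N}. i \<in> Zset n" if i: "i \<in> {1..\<eta> * R}" for i
    proof -
      have c: "(i - 1) div R < \<eta>" using i by (intro less_mult_imp_div_less) auto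
      have "srv ((i - 1) div R) \<noteq> {}"
        using bij_betw_same_card[OF pos[OF c]] M_ge by auto
      then obtain n where "n \<in> srv ((i - 1) div R)" by blast
      then show ?thesis using srv[OF c] i by (auto simp: Zset_def)
    qed
    fix n assume n: "n \<in> {1..N}"
    \<comment> \<open>Entropy is at most the logarithm of the number of values, so it suffices to
      count the stored symbols.\<close>
    let ?B = "\<lambda>(k, i). vecs (card (part k i)) :: 'f list set"
    have fin: "finite ({1..K} \<times> Zset n)" by (simp add: finite_Zset)
    have sub: "F.stored (Zset n) ` T \<subseteq> PiE ({1..K} \<times> Zset n) ?B"
    proof (rule image_subsetI)
      fix \<omega> assume "\<omega> \<in> T"
      then have "length (W k \<omega>) = L" if "k \<in> {1..K}" for k
        using W_in_vecs[OF that] by (simp add: vecs_def)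
      then show "F.stored (Zset n) \<omega> \<in> PiE ({1..K} \<times> Zset n) ?B"
        by (auto simp: F.stored_def F.packet_def vecs_def length_nths_part)
    qed
    have "F.entropy_q (F.stored (Zset n)) \<le> log CARD('f) (card (F.stored (Zset n) ` T))"
      using entropy_le_log_card by (simp add: space_U)
    also have "\<dots> \<le> log CARD('f) (card (PiE ({1..K} \<times> Zset n) ?B))"
    proof -
      have "finite (PiE ({1..K} \<times> Zset n) ?B)"
        using fin by (intro finite_PiE) (auto simp: finite_vecs)
      then have "card (F.stored (Zset n) ` T) \<le> card (PiE ({1..K} \<times> Zset n) ?B)"
        using sub by (rule card_mono)
      moreover have "0 < card (F.stored (Zset n) ` T)"
        using finite_T T_ne by (simp add: card_gt_0_iff)
      ultimately show ?thesis using b_gt by simp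
    qed
    also have "card (PiE ({1..K} \<times> Zset n) ?B) = (\<Prod>(k, i)\<in>{1..K} \<times> Zset n. CARD('f) ^ card (part k i))"
      using fin by (subst card_PiE) (auto simp: card_vecs intro!: prod.cong)
    also have "\<dots> = CARD('f) ^ (\<Sum>(k, i)\<in>{1..K} \<times> Zset n. card (part k i))"
      by (simp add: power_sum case_prod_beta)
    also have "(\<Sum>(k, i)\<in>{1..K} \<times> Zset n. card (part k i)) = K * (\<Sum>i\<in>Zset n. card (part 1 i))"
      by (simp flip: sum.cartesian_product add: part_def)
    also have "log CARD('f) (CARD('f) ^ (K * (\<Sum>i\<in>Zset n. card (part 1 i)))) =
        real (K * (\<Sum>i\<in>Zset n. card (part 1 i)))"
      using b_gt by (simp add: log_nat_power)
    also have "\<dots> = real M / real N * real K * real L"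
    proof -
      have "real (\<Sum>i\<in>Zset n. card (part 1 i)) * real N = real M * real L"
        using Zset_load[OF n, of 1] by (metis of_nat_mult)
      then show ?thesis using N_pos by (simp add: field_simps)
    qed
    finally show "F.entropy_q (F.stored (Zset n)) \<le> real M / real N * real K * real L" .
  qed
qed

end

section \<open>Entropy of the answers and download cost\<close>

lemma padded_sum_cong: "(\<And>x. x \<in> X \<Longrightarrow> f x = g x) \<Longrightarrow> padded_sum f X = padded_sum g X"
proof -
  assume eq: "\<And>x. x \<in> X \<Longrightarrow> f x = g x"
  have "(\<lambda>x. length (f x)) ` X = (\<lambda>x. length (g x)) ` X"
    by (rule image_cong) (simp_all add: eq)
  then show ?thesis by (simp add: padded_sum_def eq)
qed

context sda_code
begin

text \<open>Only stored packets enter a reply, which makes it a function of query and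
  storage.\<close>

lemma reply_cong:
  assumes "\<And>k i. k \<in> {1..K} \<Longrightarrow> i \<in> Zset n \<Longrightarrow> nths (w k) (part k i) = nths (w' k) (part k i)"
  shows "reply n v w = reply n v w'"
  unfolding reply_def by (rule map_cong[OF refl], rule padded_sum_cong) (use assms in auto)

lemma A_eq_iff:
  assumes "\<omega> \<in> T" "\<omega>' \<in> T" and "query \<theta> n (snd (h \<omega>')) = query \<theta> n (snd (h \<omega>))"
  shows "A \<theta> n \<omega>' = A \<theta> n \<omega> \<longleftrightarrow> (\<forall>j<J.
    column_answer K R idx (query \<theta> n (snd (h \<omega>))) (fst (h \<omega>')) j =
    column_answer K R idx (query \<theta> n (snd (h \<omega>))) (fst (h \<omega>)) j)"
  unfolding A_def assms(3) using assms(1,2) by (intro reply_eq_iff h_mem admissible_query)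

text \<open>For a fixed query the condition on the answer concerns the files alone, and the count of
  files with equal column answers applies. The answer is thus uniform given the query.\<close>

lemma answer_fibres:
  assumes \<omega>: "\<omega> \<in> T"
  shows "CARD('f) ^ card (active J K idx (query \<theta> n (snd (h \<omega>)))) *
      card {\<omega>'\<in>T. A \<theta> n \<omega>' = A \<theta> n \<omega> \<and> Q \<theta> n \<omega>' = Q \<theta> n \<omega>} =
    card {\<omega>'\<in>T. Q \<theta> n \<omega>' = Q \<theta> n \<omega>}"
proof -
  let ?v = "query \<theta> n (snd (h \<omega>))"
  let ?same = "\<lambda>w. \<forall>j<J. column_answer K R idx ?v w j = column_answer K R idx ?v (fst (h \<omega>)) j"
  have v: "?v (idx j, k) \<le> R" if "j < J" "k \<in> {1..K}" for j k
    using keys_less[OF query_in_keys idx_less[OF that(1)] that(2), of \<theta> n "snd (h \<omega>)"] Suc_R by linarith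
  have "{\<omega>'\<in>T. A \<theta> n \<omega>' = A \<theta> n \<omega> \<and> Q \<theta> n \<omega>' = Q \<theta> n \<omega>} =
      {\<omega>'\<in>T. ?same (fst (h \<omega>')) \<and> query \<theta> n (snd (h \<omega>')) = ?v}"
    unfolding Q_eq_iff using A_eq_iff[OF \<omega>] by blast
  then have e1: "card {\<omega>'\<in>T. A \<theta> n \<omega>' = A \<theta> n \<omega> \<and> Q \<theta> n \<omega>' = Q \<theta> n \<omega>} =
      card {w\<in>files. ?same w} * card {g\<in>keys. query \<theta> n g = ?v}"
    using card_event[of ?same "\<lambda>g. query \<theta> n g = ?v"] by (simp only:)
  have e2: "card {\<omega>'\<in>T. Q \<theta> n \<omega>' = Q \<theta> n \<omega>} = card files * card {g\<in>keys. query \<theta> n g = ?v}"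
    unfolding Q_eq_iff by (rule card_event_keys)
  have e3: "CARD('f) ^ card (active J K idx ?v) * card {w\<in>files. ?same w} = card files"
    unfolding L_def by (rule card_files_same_answers) (rule v)
  show ?thesis
    unfolding e1 e2 e3[symmetric] by (rule mult.assoc[symmetric])
qed

lemma answer_entropy:
  "conditional_entropy (real CARD('f)) (count_space (A \<theta> n ` T)) (count_space (Q \<theta> n ` T)) (A \<theta> n) (Q \<theta> n)
     = (\<Sum>g\<in>keys. real (card (active J K idx (query \<theta> n g)))) / card keys"
proof -
  \<comment> \<open>The fibre ratio has to be a function of the transmitted number, hence the
    decoding by \<open>from_nat_into\<close>.\<close>
  let ?c = "\<lambda>x. CARD('f) ^ card (active J K idx (from_nat_into keys x))"
  have "conditional_entropy (real CARD('f)) (count_space (A \<theta> n ` T)) (count_space (Q \<theta> n ` T)) (A \<theta> n) (Q \<theta> n)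
     = (\<Sum>\<omega>\<in>T. log (real CARD('f)) (?c (Q \<theta> n \<omega>))) / card T"
    by (rule conditional_entropy_fibres) (simp only: decode_Q answer_fibres)
  also have "\<dots> = (\<Sum>\<omega>\<in>T. real (card (active J K idx (query \<theta> n (snd (h \<omega>)))))) / card T"
    unfolding decode_Q using b_gt by (simp add: log_nat_power)
  also have "\<dots> = card files * (\<Sum>g\<in>keys. real (card (active J K idx (query \<theta> n g)))) / (card files * card keys)"
    by (simp only: sum_keys[of "\<lambda>g. real (card (active J K idx (query \<theta> n g)))"] card_T of_nat_mult)
  finally show ?thesis using cards_pos by simp
qed

text \<open>As a bijection of the keys, the shift preserves the probability \<open>1 / M ^ K\<close>
  that a class of the key vanishes, whatever \<theta> and the server are.\<close>

lemma card_keys_zero: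
  assumes c: "c < \<eta>"
  shows "M ^ K * card {g\<in>keys. \<forall>k\<in>{1..K}. shift \<theta> n g (c, k) = 0} = card keys"
proof -
  have "bij_betw (shift \<theta> n) {g\<in>keys. \<forall>k\<in>{1..K}. shift \<theta> n g (c, k) = 0} {g\<in>keys. \<forall>k\<in>{1..K}. g (c, k) = 0}"
  proof (rule bij_betw_subset[OF bij_shift])
    have "f ` {x\<in>X. p (f x)} = {y\<in>f ` X. p y}" for f X and p :: "(nat \<times> nat \<Rightarrow> nat) \<Rightarrow> bool"
      by blast
    from this[of "shift \<theta> n" keys "\<lambda>g. \<forall>k\<in>{1..K}. g (c, k) = 0"]
    have "shift \<theta> n ` {g\<in>keys. \<forall>k\<in>{1..K}. shift \<theta> n g (c, k) = 0} =
        {g\<in>shift \<theta> n ` keys. \<forall>k\<in>{1..K}. g (c, k) = 0}" .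
    also have "shift \<theta> n ` keys = keys" by (rule bij_betw_imp_surj_on[OF bij_shift])
    finally show "shift \<theta> n ` {g\<in>keys. \<forall>k\<in>{1..K}. shift \<theta> n g (c, k) = 0} =
      {g\<in>keys. \<forall>k\<in>{1..K}. g (c, k) = 0}" .
  qed blast
  then show ?thesis
    using card_PiE_zero_column[OF c, of M K] M_ge by (simp add: bij_betw_same_card)
qed

text \<open>By linearity of expectation each column is treated alone: it costs one symbol with
  probability \<open>1 - 1 / M ^ K\<close> at each of its \<open>M\<close> starred servers and
  nothing elsewhere.\<close>

lemma expected_download:
  "(\<Sum>n=1..N. (\<Sum>g\<in>keys. real (card (active J K idx (query \<theta> n g)))) / card keys) =
    real J * real M * (1 - 1 / real M ^ K)"
proof -
  have one: "real (card {g\<in>keys. j \<in> active J K idx (query \<theta> n g)}) / card keys =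
      (if n \<in> srv (idx j) then 1 - 1 / real M ^ K else 0)" if j: "j < J" for n j
  proof (cases "n \<in> srv (idx j)")
    case True
    let ?Z = "{g\<in>keys. \<forall>k\<in>{1..K}. shift \<theta> n g (idx j, k) = 0}"
    have "j \<in> active J K idx (query \<theta> n g) \<longleftrightarrow> \<not> (\<forall>k\<in>{1..K}. shift \<theta> n g (idx j, k) = 0)" for g
    proof -
      have eq: "query \<theta> n g (idx j, k) = shift \<theta> n g (idx j, k)" if "k \<in> {1..K}" for k
        unfolding query_apply[OF idx_less[OF j] that] shift_apply[OF idx_less[OF j] that] using True by simp
      have "j \<in> active J K idx (query \<theta> n g) \<longleftrightarrow> (\<exists>k\<in>{1..K}. query \<theta> n g (idx j, k) \<noteq> 0)"
        using j by (simp add: active_def)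
      also have "\<dots> \<longleftrightarrow> (\<exists>k\<in>{1..K}. shift \<theta> n g (idx j, k) \<noteq> 0)"
        by (rule bex_cong[OF refl]) (simp only: eq)
      finally show ?thesis by simp
    qed
    then have "{g\<in>keys. j \<in> active J K idx (query \<theta> n g)} = keys - ?Z" by blast
    moreover have "card (keys - ?Z) = card keys - card ?Z"
      using finite_keys by (intro card_Diff_subset) auto
    moreover have "card ?Z \<le> card keys"
      using finite_keys by (intro card_mono) auto
    ultimately have card1: "real (card {g\<in>keys. j \<in> active J K idx (query \<theta> n g)}) = real (card keys) - real (card ?Z)"
      by (simp only: of_nat_diff)
    have card2: "real (card keys) = real M ^ K * real (card ?Z)"
      unfolding card_keys_zero[OF idx_less[OF j], of \<theta> n, symmetric] by (simp only: of_nat_mult of_nat_power)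
    have "(a - z) / a = 1 - 1 / p" if "a = p * z" "a > 0" for a p z :: real
      using that by (auto simp: diff_divide_distrib)
    from this[OF card2] show ?thesis
      unfolding card1 using True cards_pos(2) by simp
  next
    case False
    then have "j \<notin> active J K idx (query \<theta> n g)" for g
      by (auto simp: active_def query_apply[OF idx_less[OF j]])
    then show ?thesis using False by simp
  qed
  have "(\<Sum>g\<in>keys. real (card (active J K idx (query \<theta> n g)))) / card keys =
      (\<Sum>j<J. if n \<in> srv (idx j) then 1 - 1 / real M ^ K else 0)" for n
  proof -
    \<comment> \<open>Double counting of the pairs of a key and a column active for it.\<close>
    have "(\<Sum>g\<in>keys. card (active J K idx (query \<theta> n g))) =
        (\<Sum>j<J. card {g\<in>keys. j \<in> active J K idx (query \<theta> n g)})"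
    proof -
      have "active J K idx v = {j\<in>{..<J}. j \<in> active J K idx v}" for v by (auto simp: active_def)
      then have "(\<Sum>g\<in>keys. card (active J K idx (query \<theta> n g))) =
          (\<Sum>g\<in>keys. card {j\<in>{..<J}. j \<in> active J K idx (query \<theta> n g)})"
        by (intro sum.cong[OF refl] arg_cong[where f = card])
      also have "\<dots> = (\<Sum>j<J. card {g\<in>keys. j \<in> active J K idx (query \<theta> n g)})"
        by (rule sum_multicount_gen) (use finite_keys in auto)
      finally show ?thesis .
    qed
    then have "(\<Sum>g\<in>keys. real (card (active J K idx (query \<theta> n g)))) / card keys =
        (\<Sum>j<J. real (card {g\<in>keys. j \<in> active J K idx (query \<theta> n g)}) / card keys)"
      by (simp only: of_nat_sum[symmetric] sum_divide_distrib[symmetric])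
    also have "\<dots> = (\<Sum>j<J. if n \<in> srv (idx j) then 1 - 1 / real M ^ K else 0)"
      by (rule sum.cong[OF refl]) (simp only: one lessThan_iff)
    finally show ?thesis .
  qed
  then have "(\<Sum>n=1..N. (\<Sum>g\<in>keys. real (card (active J K idx (query \<theta> n g)))) / card keys) =
      (\<Sum>n=1..N. \<Sum>j<J. if n \<in> srv (idx j) then 1 - 1 / real M ^ K else 0)"
    by (simp only:)
  also have "\<dots> = (\<Sum>j<J. \<Sum>n=1..N. if n \<in> srv (idx j) then 1 - 1 / real M ^ K else 0)"
    by (rule sum.swap)
  also have "\<dots> = (\<Sum>j<J. real M * (1 - 1 / real M ^ K))"
  proof (rule sum.cong[OF refl])
    fix j assume "j \<in> {..<J}"
    then have c: "idx j < \<eta>" by (simp add: idx_less)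
    have S: "{1..N} \<inter> srv (idx j) = srv (idx j)" using srv[OF c] by blast
    have "(\<Sum>n=1..N. if n \<in> srv (idx j) then 1 - 1 / real M ^ K else 0) = (\<Sum>n\<in>{1..N} \<inter> srv (idx j). 1 - 1 / real M ^ K)"
      by (rule sum.inter_restrict[symmetric]) simp
    then show "(\<Sum>n=1..N. if n \<in> srv (idx j) then 1 - 1 / real M ^ K else 0) = real M * (1 - 1 / real M ^ K)"
      unfolding S using bij_betw_same_card[OF pos[OF c]] by (simp del: sum.inter_restrict)
  qed
  finally show ?thesis by simp
qed

text \<open>A geometric sum with ratio \<open>1 / M\<close>, which is not 1 because \<open>M\<close>
  is at least 2; \<open>L = J * (M - 1)\<close> supplies the factor
  \<open>1 - 1 / M\<close>.\<close>

lemma rate_eq_capacity: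
  "real L / (real J * real M * (1 - 1 / real M ^ K)) = sc_pir_capacity (real M / real N) N K"
proof -
  have M: "real M > 1" using M_ge by simp
  have R: "real R = real M - 1" using M_ge by (simp add: R_def of_nat_diff)
  have "(\<Sum>j<K. 1 / real M ^ j) = (\<Sum>j<K. (1 / real M) ^ j)"
    by (simp add: power_one_over)
  also have "\<dots> = (1 - (1 / real M) ^ K) / (1 - 1 / real M)"
    using M by (subst sum_gp_strict) auto
  finally have "inverse (\<Sum>j<K. 1 / real M ^ j) = (1 - 1 / real M) / (1 - 1 / real M ^ K)"
    by (simp add: power_one_over)
  moreover have "real M / real N * real N = real M" using N_pos by simp
  moreover have "real L / (real J * real M * (1 - 1 / real M ^ K)) = (1 - 1 / real M) / (1 - 1 / real M ^ K)"
  proof -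
    have "(1 - 1 / real M) = real L / (J * M)"
      using M J_pos by (simp add: L_def R field_simps)
    then show ?thesis by simp
  qed
  ultimately show ?thesis by (simp add: sc_pir_capacity_def)
qed

text \<open>The right-hand side does not mention \<theta>: the shift is a bijection of the uniform
  keys and leaves the files fixed. The function \<open>f\<close> stands for the storage
  contents.\<close>

lemma privacy_distr:
  "distr U (count_space UNIV) (\<lambda>\<omega>. (Q \<theta> n \<omega>, A \<theta> n \<omega>, f (fst (h \<omega>)))) =
   distr (uniform_count_measure (files \<times> keys)) (count_space UNIV)
     (\<lambda>(w, g). (to_nat_on keys (mask n g), reply n (mask n g) w, f w))"
proof -
  let ?X = "\<lambda>(w, g). (to_nat_on keys (mask n g), reply n (mask n g) w, f w)"
  let ?\<sigma> = "\<lambda>(w, g). (w, shift \<theta> n g)"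
  have "bij_betw ?\<sigma> (files \<times> keys) (files \<times> keys)"
    using bij_betw_map_prod[OF bij_betw_id[of files] bij_shift[of \<theta> n]]
    by (simp add: map_prod_def)
  then have "distr (uniform_count_measure (files \<times> keys)) (count_space UNIV) (\<lambda>s. ?X (?\<sigma> s)) =
      distr (uniform_count_measure (files \<times> keys)) (count_space UNIV) ?X"
    using finite_files finite_keys by (intro distr_uniform_count_measure_bij) auto
  moreover have "distr U (count_space UNIV) (\<lambda>\<omega>. ?X (?\<sigma> (h \<omega>))) =
      distr (uniform_count_measure (files \<times> keys)) (count_space UNIV) (\<lambda>s. ?X (?\<sigma> s))"
    using distr_uniform_count_measure_bij[OF bij_h finite_T, of "\<lambda>s. ?X (?\<sigma> s)"] by simp
  ultimately show ?thesis
    by (simp add: Q_def A_def query_def case_prod_beta)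
qed

section \<open>Verification of the scheme\<close>

lemma capacity_achieving_scheme:
  "capacity_achieving_linear_sc_pir_scheme U (real CARD('f)) K L (\<eta> * R) W part (real M / real N) N Zset Q A"
proof -
  interpret F: sc_pir_storage U "real CARD('f)" K L "\<eta> * R" W part "real M / real N" N Zset
    by (rule sc_pir_storage)
  interpret S: sc_pir_scheme U "real CARD('f)" K L "\<eta> * R" W part "real M / real N" N Zset Q A
  proof unfold_locales
    fix \<theta> n assume \<theta>: "\<theta> \<in> {1..K}" and n: "n \<in> {1..N}"
    show "simple_function U (Q \<theta> n)" "simple_function U (A \<theta> n)" by (rule simple_function_U)+
    have det: "reply n (query \<theta> n (snd (h \<omega>))) (fst (h \<omega>)) = reply n (query \<theta> n (snd (h \<omega>'))) (fst (h \<omega>'))"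
      if "(Q \<theta> n \<omega>, F.Z n \<omega>) = (Q \<theta> n \<omega>', F.Z n \<omega>')" for \<omega> \<omega>'
    proof -
      have q: "query \<theta> n (snd (h \<omega>)) = query \<theta> n (snd (h \<omega>'))" and z: "F.Z n \<omega> = F.Z n \<omega>'"
        using that by (simp_all add: Q_eq_iff)
      show ?thesis unfolding q
      proof (rule reply_cong)
        fix k i assume "k \<in> {1..K}" "i \<in> Zset n"
        then show "nths (fst (h \<omega>) k) (part k i) = nths (fst (h \<omega>') k) (part k i)"
          using fun_cong[OF z, of "(k, i)"] by (simp add: F.stored_def F.packet_def W_def)
      qed
    qed
    show "F.conditional_entropy_q (A \<theta> n) (\<lambda>\<omega>. (Q \<theta> n \<omega>, F.Z n \<omega>)) = 0"
      unfolding space_U A_def by (rule conditional_entropy_function) (rule det)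
  next
    fix \<theta> assume \<theta>: "\<theta> \<in> {1..K}"
    show "F.mutual_information_q (\<lambda>\<omega>. \<lambda>n\<in>{1..N}. Q \<theta> n \<omega>) F.all_files = 0"
      unfolding space_U
    proof (rule mutual_information_eq_0)
      fix \<omega> assume "\<omega> \<in> T"
      let ?x = "\<lambda>g. \<lambda>n\<in>{1..N}. to_nat_on keys (query \<theta> n g)"
      let ?y = "\<lambda>w. \<lambda>k\<in>{1..K}. w k :: 'f list"
      \<comment> \<open>All queries together are a function of the key, and the files do not involve
        the key; the product count then gives independence.\<close>
      have eq: "(\<lambda>\<omega>. \<lambda>n\<in>{1..N}. Q \<theta> n \<omega>) = (\<lambda>\<omega>. ?x (snd (h \<omega>)))" "F.all_files = (\<lambda>\<omega>. ?y (fst (h \<omega>)))"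
        by (simp_all add: fun_eq_iff Q_def F.all_files_def W_def)
      let ?a = "card {w\<in>files. ?y w = ?y (fst (h \<omega>))}" and ?b = "card {g\<in>keys. ?x g = ?x (snd (h \<omega>))}"
      have "card {\<omega>'\<in>T. ?x (snd (h \<omega>')) = ?x (snd (h \<omega>)) \<and> ?y (fst (h \<omega>')) = ?y (fst (h \<omega>))} = ?a * ?b"
        using card_event[of "\<lambda>w. ?y w = ?y (fst (h \<omega>))" "\<lambda>g. ?x g = ?x (snd (h \<omega>))"]
        by (simp only: conj_commute)
      moreover have "card {\<omega>'\<in>T. ?x (snd (h \<omega>')) = ?x (snd (h \<omega>))} = card files * ?b"
        by (rule card_event_keys)
      moreover have "card {\<omega>'\<in>T. ?y (fst (h \<omega>')) = ?y (fst (h \<omega>))} = ?a * card keys"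
        by (rule card_event_files)
      ultimately show "card {\<omega>'\<in>T. (\<lambda>n\<in>{1..N}. Q \<theta> n \<omega>') = (\<lambda>n\<in>{1..N}. Q \<theta> n \<omega>) \<and>
            F.all_files \<omega>' = F.all_files \<omega>} * card T =
          card {\<omega>'\<in>T. (\<lambda>n\<in>{1..N}. Q \<theta> n \<omega>') = (\<lambda>n\<in>{1..N}. Q \<theta> n \<omega>)} *
          card {\<omega>'\<in>T. F.all_files \<omega>' = F.all_files \<omega>}"
        unfolding fun_cong[OF eq(1)] fun_cong[OF eq(2)] card_T by (simp only: mult_ac)
    qed
    show "F.conditional_entropy_q (W \<theta>) (\<lambda>\<omega>. (\<lambda>n\<in>{1..N}. A \<theta> n \<omega>, \<lambda>n\<in>{1..N}. Q \<theta> n \<omega>)) = 0"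
      unfolding space_U
    proof (rule conditional_entropy_function)
      fix \<omega> \<omega>' assume \<omega>: "\<omega> \<in> T" "\<omega>' \<in> T"
        and "(\<lambda>n\<in>{1..N}. A \<theta> n \<omega>, \<lambda>n\<in>{1..N}. Q \<theta> n \<omega>) = (\<lambda>n\<in>{1..N}. A \<theta> n \<omega>', \<lambda>n\<in>{1..N}. Q \<theta> n \<omega>')"
      then have eqs: "(\<lambda>n\<in>{1..N}. A \<theta> n \<omega>) = (\<lambda>n\<in>{1..N}. A \<theta> n \<omega>')"
        "(\<lambda>n\<in>{1..N}. Q \<theta> n \<omega>) = (\<lambda>n\<in>{1..N}. Q \<theta> n \<omega>')" by blast+
      have a: "A \<theta> n \<omega> = A \<theta> n \<omega>'" if "n \<in> {1..N}" for n
        using fun_cong[OF eqs(1), of n] that by simp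
      have q: "query \<theta> n (snd (h \<omega>)) = query \<theta> n (snd (h \<omega>'))" if "n \<in> {1..N}" for n
        using fun_cong[OF eqs(2), of n] that by (simp add: Q_eq_iff)
      show "W \<theta> \<omega> = W \<theta> \<omega>'"
        unfolding W_def
        by (rule decode[OF \<theta> h_mem(1)[OF \<omega>(1)] h_mem(1)[OF \<omega>(2)] h_mem(2)[OF \<omega>(1)] h_mem(2)[OF \<omega>(2)] q a[unfolded A_def]])
    qed
  next
    fix \<theta> \<theta>' n assume "\<theta> \<in> {1..K}" "\<theta>' \<in> {1..K}" "n \<in> {1..N}"
    let ?f = "\<lambda>w. \<lambda>(k, i)\<in>{1..K} \<times> Zset n. nths (w k) (part k i) :: 'f list"
    have Z: "F.Z n = (\<lambda>\<omega>. ?f (fst (h \<omega>)))"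
      by (simp add: fun_eq_iff F.stored_def F.packet_def W_def)
    show "distr U (count_space UNIV) (\<lambda>\<omega>. (Q \<theta> n \<omega>, A \<theta> n \<omega>, F.Z n \<omega>)) =
      distr U (count_space UNIV) (\<lambda>\<omega>. (Q \<theta>' n \<omega>, A \<theta>' n \<omega>, F.Z n \<omega>))"
      unfolding Z by (rule trans[OF privacy_distr[of \<theta> n ?f] privacy_distr[of \<theta>' n ?f, symmetric]])
  qed
  show ?thesis
  proof unfold_locales
    \<comment> \<open>Every reply has one entry per class, so the length is constantly
      \<open>\<eta>\<close>.\<close>
    show "\<exists>(len :: nat \<Rightarrow> nat \<Rightarrow> nat) (coef :: nat \<Rightarrow> nat \<Rightarrow> nat \<Rightarrow> nat \<Rightarrow> nat \<Rightarrow> 'f).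
       \<forall>\<theta>\<in>{1..K}. \<forall>n\<in>{1..N}. \<forall>\<omega>\<in>space U.
         A \<theta> n \<omega> =
           map (\<lambda>j. padded_sum (\<lambda>(k, i). map ((*) (coef n (Q \<theta> n \<omega>) k i j)) (F.packet k i \<omega>))
                      ({1..K} \<times> Zset n))
             [1..<Suc (len n (Q \<theta> n \<omega>))]"
      by (rule exI[of _ "\<lambda>_ _. \<eta>"], rule exI[of _ "\<lambda>_ x. coef (from_nat_into keys x)"])
        (intro ballI, simp only: decode_Q A_def reply_def F.packet_def W_def)
    show "S.retrieval_rate \<theta> = sc_pir_capacity (real M / real N) N K" if "\<theta> \<in> {1..K}" for \<theta>
      unfolding S.retrieval_rate_def S.download_cost_def space_U answer_entropy expected_download
      by (rule rate_eq_capacity)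
  qed
qed

end

section \<open>From the array to the code\<close>

theorem theorem4:
  fixes N K M :: nat and P :: "nat \<Rightarrow> nat \<Rightarrow> sda_entry"
  assumes "1 \<le> N" and "1 \<le> K" and "M \<in> {2..N}" and "sda N M P"
  shows "\<exists>(\<Omega> :: nat measure) (L :: nat) (W :: nat \<Rightarrow> nat \<Rightarrow> 'f::{finite,field} list)
           (part :: nat \<Rightarrow> nat \<Rightarrow> nat set) (Zset :: nat \<Rightarrow> nat set)
           (Q :: nat \<Rightarrow> nat \<Rightarrow> nat \<Rightarrow> nat) (A :: nat \<Rightarrow> nat \<Rightarrow> nat \<Rightarrow> 'f list list).
           capacity_achieving_linear_sc_pir_scheme \<Omega> (real CARD('f)) K L
             (num_distinct_columns N M P * (M - 1)) W part (real M / real N) N Zset Q A"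
proof -
  define J where "J = N div gcd N M"
  define C where "C = sda_column N P ` {1..J}"
  define \<eta> where "\<eta> = card C"
  \<comment> \<open>\<open>e\<close> numbers the distinct columns, so equal columns fall into one
    class and there are \<open>\<eta>\<close> classes.\<close>
  obtain e where e: "bij_betw e C {0..<\<eta>}"
    unfolding \<eta>_def using ex_bij_betw_finite_nat[of C] by (auto simp: C_def)
  define idx where "idx j = e (sda_column N P (Suc j))" for j
  \<comment> \<open>\<open>inv_into C e c\<close> recovers the column shared by class
    \<open>c\<close>.\<close>
  define srv where "srv c = {n\<in>{1..N}. inv_into C e c n = Star}" for c
  have J: "1 \<le> J" using assms(1) by (simp add: J_def div_greater_zero_iff Suc_le_eq)
  have col: "sda_column N P (Suc j) \<in> C" if "j < J" for j
    using that by (auto simp: C_def)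
  have srv_idx: "srv (idx j) = {n\<in>{1..N}. P n (Suc j) = Star}" if "j < J" for j
    using col[OF that] e
    by (auto simp: srv_def idx_def bij_betw_def sda_column_def inv_into_f_f)
  have idx: "idx ` {..<J} = {..<\<eta>}"
  proof -
    have "idx ` {..<J} = e ` sda_column N P ` Suc ` {..<J}" by (auto simp: idx_def)
    also have "Suc ` {..<J} = {1..J}" by (simp add: image_Suc_lessThan)
    finally show ?thesis using e by (simp add: C_def bij_betw_def atLeast0LessThan)
  qed
  have card_srv: "card (srv c) = M" if "c < \<eta>" for c
  proof -
    obtain j where j: "j < J" "c = idx j" using idx \<open>c < \<eta>\<close> by (metis imageE lessThan_iff)
    then have "Suc j \<in> {1..N div gcd N M}" by (simp add: J_def)
    then show ?thesis using assms(4) by (simp add: j(2) srv_idx[OF j(1)] sda_def)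
  qed
  have "\<exists>p. bij_betw p (srv c) {..<M}" if "c < \<eta>" for c
    using ex_bij_betw_finite_nat[of "srv c"] card_srv[OF that] by (simp add: srv_def atLeast0LessThan)
  then obtain pos where pos: "\<And>c. c < \<eta> \<Longrightarrow> bij_betw (pos c) (srv c) {..<M}" by metis
  have load: "card {j\<in>{..<J}. n \<in> srv (idx j)} * N = M * J" if n: "n \<in> {1..N}" for n
  proof -
    have "Suc ` {j\<in>{..<J}. n \<in> srv (idx j)} = {j\<in>{1..J}. P n j = Star}"
    proof -
      have "{j\<in>{..<J}. n \<in> srv (idx j)} = {j\<in>{..<J}. P n (Suc j) = Star}"
        using n srv_idx by auto
      then have "Suc ` {j\<in>{..<J}. n \<in> srv (idx j)} = {j\<in>Suc ` {..<J}. P n j = Star}" by auto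
      then show ?thesis by (simp add: image_Suc_lessThan)
    qed
    then have "card {j\<in>{..<J}. n \<in> srv (idx j)} = card {j\<in>{1..J}. P n j = Star}"
      using card_image[of Suc "{j\<in>{..<J}. n \<in> srv (idx j)}"] by simp
    also have "\<dots> = M div gcd N M"
      using assms(4) n by (simp add: sda_def J_def)
    \<comment> \<open>Since the gcd divides both numbers, both sides equal
      \<open>M * N div gcd N M\<close>.\<close>
    finally show ?thesis
      by (simp add: J_def div_mult_swap dvd_div_mult)
  qed
  \<comment> \<open>Numbering the pairs of files and key puts the sample space on the natural
    numbers; the uniform measure there makes files and key uniform and independent.\<close>
  let ?S = "({1..K} \<rightarrow>\<^sub>E (vecs (J * (M - 1)) :: 'f list set)) \<times> (({..<\<eta>} \<times> {1..K}) \<rightarrow>\<^sub>E {..<M})"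
  have "finite ?S" by (intro finite_cartesian_product finite_PiE) (auto simp: finite_vecs)
  then obtain h where h: "bij_betw h {0..<card ?S} ?S" using ex_bij_betw_nat_finite by blast
  interpret sda_code N K M J \<eta> idx srv pos "{0..<card ?S}" h
  proof
    show "1 \<le> N" "1 \<le> K" "1 \<le> J" "2 \<le> M" using assms J by simp_all
    show "srv c \<subseteq> {1..N}" for c by (auto simp: srv_def)
  qed (fact idx pos load h)+
  have "num_distinct_columns N M P = \<eta>"
    by (simp add: num_distinct_columns_def \<eta>_def C_def J_def)
  then show ?thesis
    using capacity_achieving_scheme[unfolded R_def] by (intro exI) (simp only:)
qed

end
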